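(* Let $q>6.3\cdot 3^{13/3}$ be a prime power and let $f_1,f_2,f_3\in\mathbb{F}_q[X,Y,Z]$ be polynomials of degree $2$ with $f_i(0,0,0)=0$. If \[ \mathcal{O}_7(f_1,f_2,f_3)=\{(1,x,y,z,f_1(x,y,z),f_2(x,y,z),f_3(x,y,z),-zf_1(x,y,z)-yf_2(x,y,z)-xf_3(x,y,z)) : x,y,z\in\mathbb{F}_q\}\cup\{(0,0,0,0,0,0,0,1)\} \] is an ovoid of the hyperbolic quadric $Q: X_0X_7+X_1X_6+X_2X_5+X_3X_4=0$ of $\mathrm{PG}(7,q)$, then $q$ is even and $\mathcal{O}_7(f_1,f_2,f_3)$ is the Kantor ovoid.
   Context: An ovoid of $Q$ is a set of points of $Q$ meeting every generator (maximal totally singular subspace) of $Q$ in exactly one point. For $q=2^h$, the Kantor ovoid is defined as follows: on the $8$-dimensional $\mathbb{F}_q$-space $\mathbb{V}=\mathbb{F}_q\oplus\mathbb{F}_{q^3}\oplus\mathbb{F}_{q^3}\oplus\mathbb{F}_q$ with quadratic form $Q((a,\gamma,\delta,d))=ad+\mathrm{Tr}_{q^3/q}(\gamma\delta)$ (a hyperbolic quadric $Q^+(7,q)$), it is the set $\{(0,0,0,1)\}\cup\{(1,t,t^{q+q^2},\mathrm{N}_{q^3/q}(t)) : t\in\mathbb{F}_{q^3}\}$; it is transported to the quadric $Q$ above by writing $t=x+y\alpha+z\beta$ for an $\mathbb{F}_q$-basis $\{1,\alpha,\beta\}$ of $\mathbb{F}_{q^3}$ and expressing $t^{q+q^2}=xf_3(x,y,z)+yf_2(x,y,z)+zf_1(x,y,z)$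 for suitable quadratic forms $f_1,f_2,f_3$ with coefficients in $\mathbb{F}_q$ depending on $\alpha,\beta$. *)

theory Defs
  imports
    "HOL-Analysis.Cartesian_Space"
    "HOL-Library.Poly_Mapping"
    "HOL-Algebra.Algebraic_Closure_Type"
begin

text \<open>The field of order \<open>q\<close> is a type \<open>'k\<close> of class field and finite, with \<open>q = CARD('k)\<close>.\<close>


subsection \<open>Polynomials in three variables\<close>

text \<open>The monoid algebra of \<open>\<nat>\<^sup>3\<close>: the key \<open>(i, j, k)\<close> is the monomial \<open>X\<^sup>i Y\<^sup>j Z\<^sup>k\<close>.\<close>

type_synonym 'k poly3 = "(nat \<times> nat \<times> nat) \<Rightarrow>\<^sub>0 'k"

definition eval3 :: "'k::comm_ring_1 poly3 \<Rightarrow> 'k \<Rightarrow> 'k \<Rightarrow> 'k \<Rightarrow> 'k" where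
  "eval3 f x y z =
     (\<Sum>(i, j, k)\<in>Poly_Mapping.keys f. Poly_Mapping.lookup f (i, j, k) * x ^ i * y ^ j * z ^ k)"

definition total_degree3 :: "'k::zero poly3 \<Rightarrow> nat" where
  "total_degree3 f = Max (insert 0 ((\<lambda>(i, j, k). i + j + k) ` Poly_Mapping.keys f))"


subsection \<open>Quadrics and ovoids\<close>

text \<open>Points of the projective space are one-dimensional subspaces.\<close>

definition proj_point :: "'k::field ^ 'n \<Rightarrow> ('k ^ 'n) set" where
  "proj_point v = vec.span {v}"

definition quadric_points :: "('k::field ^ 'n \<Rightarrow> 'k) \<Rightarrow> ('k ^ 'n) set set" where
  "quadric_points Q = {proj_point v | v. v \<noteq> 0 \<and> Q v = 0}"

definition totally_singular :: "('k::field ^ 'n \<Rightarrow> 'k) \<Rightarrow> ('k ^ 'n) set \<Rightarrow> bool" where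
  "totally_singular Q W \<longleftrightarrow> vec.subspace W \<and> (\<forall>w\<in>W. Q w = 0)"

definition is_generator :: "('k::field ^ 'n \<Rightarrow> 'k) \<Rightarrow> ('k ^ 'n) set \<Rightarrow> bool" where
  "is_generator Q W \<longleftrightarrow>
     totally_singular Q W \<and> (\<forall>W'. totally_singular Q W' \<and> W \<subseteq> W' \<longrightarrow> W' = W)"

definition is_ovoid :: "('k::field ^ 'n \<Rightarrow> 'k) \<Rightarrow> ('k ^ 'n) set set \<Rightarrow> bool" where
  "is_ovoid Q S \<longleftrightarrow>
     S \<subseteq> quadric_points Q \<and> (\<forall>W. is_generator Q W \<longrightarrow> (\<exists>!P. P \<in> S \<and> P \<subseteq> W))"

text \<open>The index type \<open>8\<close> consists of the residues \<open>0, \<dots>, 7\<close>, so \<open>v $ i\<close> is the coordinate \<open>X\<^sub>i\<close>.\<close>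

definition vec8 :: "'k \<Rightarrow> 'k \<Rightarrow> 'k \<Rightarrow> 'k \<Rightarrow> 'k \<Rightarrow> 'k \<Rightarrow> 'k \<Rightarrow> 'k \<Rightarrow> 'k ^ 8" where
  "vec8 a0 a1 a2 a3 a4 a5 a6 a7 =
     (\<chi> i. if i = 0 then a0 else if i = 1 then a1 else if i = 2 then a2 else if i = 3 then a3
           else if i = 4 then a4 else if i = 5 then a5 else if i = 6 then a6 else a7)"

definition Q7 :: "'k::field ^ 8 \<Rightarrow> 'k" where
  "Q7 v = v $ 0 * v $ 7 + v $ 1 * v $ 6 + v $ 2 * v $ 5 + v $ 3 * v $ 4"

definition O7 :: "'k::field poly3 \<Rightarrow> 'k poly3 \<Rightarrow> 'k poly3 \<Rightarrow> ('k ^ 8) set set" where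
  "O7 f1 f2 f3 =
     {proj_point (vec8 1 x y z (eval3 f1 x y z) (eval3 f2 x y z) (eval3 f3 x y z)
        (- z * eval3 f1 x y z - y * eval3 f2 x y z - x * eval3 f3 x y z)) | x y z. True}
     \<union> {proj_point (vec8 0 0 0 0 0 0 0 1)}"


subsection \<open>The Kantor ovoid\<close>

text \<open>
  The fields of order \<open>q\<close> and \<open>q\<^sup>3\<close> are taken inside the algebraic closure of \<open>'k\<close>.
\<close>

definition Fq :: "'k::{field, finite} alg_closure set" where
  "Fq = range to_ac"

definition Fq3 :: "'k::{field, finite} alg_closure set" where
  "Fq3 = {x. x ^ (CARD('k) ^ 3) = x}"

definition Tr3 :: "'k::{field, finite} alg_closure \<Rightarrow> 'k alg_closure" where
  "Tr3 x = x + x ^ CARD('k) + x ^ (CARD('k) ^ 2)"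

definition N3 :: "'k::{field, finite} alg_closure \<Rightarrow> 'k alg_closure" where
  "N3 x = x * x ^ CARD('k) * x ^ (CARD('k) ^ 2)"

type_synonym 'k kantor_vec =
  "'k alg_closure \<times> 'k alg_closure \<times> 'k alg_closure \<times> 'k alg_closure"

definition kantor_space :: "'k::{field, finite} kantor_vec set" where
  "kantor_space = Fq \<times> Fq3 \<times> Fq3 \<times> Fq"

fun kantor_scale :: "'k::{field, finite} \<Rightarrow> 'k kantor_vec \<Rightarrow> 'k kantor_vec" where
  "kantor_scale c (a, g, e, d) = (to_ac c * a, to_ac c * g, to_ac c * e, to_ac c * d)"

text \<open>On \<^const>\<open>kantor_space\<close> this form takes values in \<^const>\<open>Fq\<close>.\<close>

fun kantor_form :: "'k::{field, finite} kantor_vec \<Rightarrow> 'k alg_closure" where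
  "kantor_form (a, g, e, d) = a * d + Tr3 (g * e)"

definition kantor_vectors :: "'k::{field, finite} kantor_vec set" where
  "kantor_vectors =
     {(0, 0, 0, 1)} \<union> {(1, t, t ^ (CARD('k) + CARD('k) ^ 2), N3 t) | t. t \<in> Fq3}"

text \<open>
  Linear isometries from \<^const>\<open>kantor_space\<close> onto the coordinate space with the form \<^const>\<open>Q7\<close>.
  A basis \<open>1, \<alpha>, \<beta>\<close> of the field of order \<open>q\<^sup>3\<close> gives the one that maps
  \<open>(a, x + y \<alpha> + z \<beta>, \<delta>, d)\<close> to \<open>(a, x, y, z, Tr (\<beta> \<delta>), Tr (\<alpha> \<delta>), Tr \<delta>, d)\<close>;
  any two of them differ by an element of the orthogonal group of \<^const>\<open>Q7\<close>.
\<close>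

definition kantor_isometry :: "('k::{field, finite} kantor_vec \<Rightarrow> 'k ^ 8) \<Rightarrow> bool" where
  "kantor_isometry \<phi> \<longleftrightarrow>
     bij_betw \<phi> kantor_space UNIV \<and>
     (\<forall>u\<in>kantor_space. \<forall>w\<in>kantor_space. \<phi> (u + w) = \<phi> u + \<phi> w) \<and>
     (\<forall>c. \<forall>u\<in>kantor_space. \<phi> (kantor_scale c u) = c *s \<phi> u) \<and>
     (\<forall>u\<in>kantor_space. to_ac (Q7 (\<phi> u)) = kantor_form u)"

text \<open>
  Being the Kantor ovoid is meant up to the orthogonal group of \<^const>\<open>Q7\<close>. In even characteristic
  every similarity of the form is a scalar multiple of an isometry, so this is the same as being
  its image under a projectivity that preserves the quadric.
\<close>

definition is_kantor_ovoid :: "('k::{field, finite} ^ 8) set set \<Rightarrow> bool" where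
  "is_kantor_ovoid S \<longleftrightarrow>
     (\<exists>\<phi>. kantor_isometry \<phi> \<and> S = (\<lambda>u. proj_point (\<phi> u)) ` kantor_vectors)"

end

theory Submission
  imports Defs "HOL-Computational_Algebra.Polynomial_Factorial"
begin

text \<open>
  For points \<open>u\<close> and \<open>u + w\<close> of the affine part, non-orthogonality reads \<open>w \<bullet> (F (u + w) - F u) \<noteq> 0\<close>
  with \<open>F = (f\<^sub>3, f\<^sub>2, f\<^sub>1)\<close>. For quadratic \<open>F\<close> this is affine linear in \<open>u\<close>, so the linear part vanishes
  identically. In odd characteristic this kills the quadratic parts of the \<open>f\<^sub>i\<close>; in characteristic
  two it makes \<open>F\<close>, up to an alternating linear map, the gradient of the ternary cubic
  \<open>C w = w \<bullet> F w\<close>, which has no nontrivial zero.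

  A ternary cubic without zeros over a field of order \<open>q = 2 ^ h\<close> is, up to a scalar, the norm of a linear form
  with values in the field of order \<open>q\<^sup>3\<close>. Write it as \<open>s\<^sup>3 + c(y, z) s + d(y, z)\<close>. The
  cubic in \<open>s\<close> never has a root, so the Frobenius permutes its roots cyclically and
  \<open>c\<^sup>3 / d\<^sup>2 + 1\<close> is of the form \<open>u\<^sup>2 + u\<close> at every \<open>(y, z)\<close>. A lacunary polynomial argument shows
  that this holds identically up to a constant, \<open>c\<^sup>3 = v\<^sup>2 + v d + k d\<^sup>2\<close>. Over the closure the right-hand side is a product of
  two coprime cubics, hence \<open>c = m n\<close> and \<open>d = m\<^sup>3 + n\<^sup>3\<close> with linear \<open>m\<close> and \<open>n\<close>, and
  \<open>s\<^sup>3 + m n s + m\<^sup>3 + n\<^sup>3\<close> splits into three linear forms which the Frobenius permutes cyclically.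
\<close>

no_notation fps_nth (infixl "$" 75)

subsection \<open>Characteristic two and finite fields\<close>

lemma char2_simps:
  fixes x y :: "'a::comm_ring_1"
  assumes "(2::'a) = 0"
  shows "x + x = 0" and "x + (x + y) = y" and "- x = x" and "x - y = x + y"
proof -
  show *: "z + z = 0" for z :: 'a
    using assms by (metis mult_2 mult_zero_left)
  show "x + (x + y) = y"
    by (metis * add.assoc add_0)
  show "- x = x"
    using *[of x] by (rule minus_unique)
  show "x - y = x + y"
    using *[of y] by (metis minus_unique uminus_add_conv_diff add.commute)
qed

lemma char2_power_add:
  fixes x y :: "'a::comm_ring_1"
  assumes "(2::'a) = 0"
  shows "(x + y) ^ (2 ^ n) = x ^ (2 ^ n) + y ^ (2 ^ n)"
proof (induction n)
  case (Suc n)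
  have "(x + y) ^ (2 ^ Suc n) = ((x + y) ^ (2 ^ n))\<^sup>2"
    by (simp add: power_mult[symmetric] mult.commute)
  also have "\<dots> = (x ^ (2 ^ n))\<^sup>2 + (y ^ (2 ^ n))\<^sup>2"
    using assms by (simp add: Suc power2_sum)
  finally show ?case
    by (simp add: power_mult[symmetric] mult.commute)
qed simp

lemma char2_square_add:
  fixes x y :: "'a::comm_ring_1"
  assumes "(2::'a) = 0"
  shows "(x + y)\<^sup>2 = x\<^sup>2 + y\<^sup>2"
  using char2_power_add[OF assms, of x y 1] by simp

lemma char2_square_inject:
  fixes x y :: "'a::idom"
  assumes "(2::'a) = 0" and "x\<^sup>2 = y\<^sup>2"
  shows "x = y"
proof -
  have "(x + y)\<^sup>2 = 0"
    using assms by (simp add: char2_square_add char2_simps)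
  then show ?thesis
    by (metis assms(1) char2_simps(4) eq_iff_diff_eq_0 power2_eq_square mult_eq_0_iff)
qed

lemma char2_power_sum:
  fixes f :: "'b \<Rightarrow> 'a::comm_ring_1"
  assumes "(2::'a) = 0"
  shows "(\<Sum>i\<in>A. f i) ^ (2 ^ n) = (\<Sum>i\<in>A. f i ^ (2 ^ n))"
  by (induction A rule: infinite_finite_induct) (simp_all add: char2_power_add[OF assms] power_0_left)

lemma char2_poly: "(2::'a::comm_ring_1) = 0 \<Longrightarrow> (2::'a poly) = 0"
  by (metis of_nat_0 of_nat_numeral of_nat_poly pCons_0_0)

lemma char2_to_ac: "(2::'k::field) = 0 \<Longrightarrow> (2::'k alg_closure) = 0"
  by (metis to_ac_0 to_ac_numeral)

text \<open>An additive subgroup of largest order \<open>2 ^ n\<close> is the whole field, since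
  adjoining a missing \<open>x\<close> would double it.\<close>

lemma char2_card:
  assumes two: "(2::'k::{field,finite}) = 0"
  obtains h where "CARD('k) = 2 ^ h"
proof -
  define P where "P n \<longleftrightarrow> (\<exists>H :: 'k set. 0 \<in> H \<and> (\<forall>x\<in>H. \<forall>y\<in>H. x + y \<in> H) \<and> card H = 2 ^ n)" for n
  have "P 0"
    unfolding P_def by (intro exI[of _ "{0}"]) simp
  moreover have bd: "n \<le> CARD('k)" if n: "P n" for n
  proof -
    obtain H :: "'k set" where "card H = 2 ^ n"
      using n unfolding P_def by blast
    then have "2 ^ n \<le> CARD('k)"
      by (metis card_mono finite subset_UNIV)
    then show ?thesis
      by (meson less_exp less_imp_le order_trans)
  qed
  ultimately obtain n where n: "P n" "\<And>m. P m \<Longrightarrow> m \<le> n"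
    using GreatestI_nat[of P 0 "CARD('k)"] Greatest_le_nat[of P _ "CARD('k)"] by metis
  obtain H :: "'k set" where H: "0 \<in> H" "\<And>x y. x \<in> H \<Longrightarrow> y \<in> H \<Longrightarrow> x + y \<in> H" "card H = 2 ^ n"
    using n(1) unfolding P_def by blast
  have "H = UNIV"
  proof (rule ccontr)
    assume "H \<noteq> UNIV"
    then obtain x where x: "x \<notin> H"
      by blast
    define H' where "H' = H \<union> (+) x ` H"
    have "H \<inter> (+) x ` H = {}"
    proof -
      have "x \<in> H" if "a \<in> H" "x + a \<in> H" for a
        using H(2)[OF that(2,1)] by (simp add: add.assoc char2_simps[OF two])
      then show ?thesis
        using x by auto
    qed
    then have "card H' = 2 ^ Suc n"
      unfolding H'_def by (subst card_Un_disjoint) (simp_all add: card_image H(3))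
    moreover have "a + b \<in> H'" if "a \<in> H'" "b \<in> H'" for a b
    proof -
      have H': "c \<in> H' \<longleftrightarrow> c \<in> H \<or> x + c \<in> H" for c
        unfolding H'_def by (metis (no_types, lifting) Un_iff char2_simps(2)[OF two] imageE image_eqI)
      have "x + a + (x + b) = a + b"
        by (metis add.assoc add.left_commute char2_simps(2)[OF two])
      moreover have "x + (a + b) = x + a + b" "x + (a + b) = a + (x + b)"
        by (simp_all add: algebra_simps)
      ultimately show ?thesis
        using that H(2) unfolding H' by metis
    qed
    ultimately have "P (Suc n)"
      unfolding P_def using H(1) by (intro exI[of _ H']) (auto simp: H'_def)
    then show False
      using n(2) by fastforce
  qed
  then show ?thesis
    using H(3) that by simp
qed

section \<open>The Frobenius map and the fields of order \<open>q\<close> and \<open>q ^ 3\<close>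
  in the closure\<close>

lemma finite_field_power_card:
  fixes x :: "'k::{field,finite}"
  shows "x ^ CARD('k) = x"
proof (cases "x = 0")
  case False
  \<comment> \<open>Multiplication by \<open>x\<close> permutes the nonzero elements and so
    preserves their product.\<close>
  have "(\<Prod>y\<in>UNIV-{0}. x * y) = (\<Prod>y\<in>UNIV-{0}. y)"
    by (rule prod.reindex_bij_witness[of _ "\<lambda>y. y / x" "\<lambda>y. x * y"]) (use False in auto)
  then have "x ^ (CARD('k) - 1) * \<Prod>(UNIV-{0}) = \<Prod>(UNIV-{0::'k})"
    by (simp add: prod.distrib)
  then have "x ^ (CARD('k) - 1) = 1"
    by simp
  then show ?thesis
    by (metis power_eq_if mult.right_neutral zero_less_card_finite less_numeral_extra(3))
qed simp

lemma finite_field_sqrt: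
  fixes x :: "'k::{field,finite}"
  assumes two: "(2::'k) = 0"
  obtains y where "y\<^sup>2 = x"
proof -
  have "inj (\<lambda>y::'k. y\<^sup>2)"
    using char2_square_inject[OF two] by (auto intro: injI)
  then have "surj (\<lambda>y::'k. y\<^sup>2)"
    by (simp add: finite_UNIV_inj_surj)
  then show ?thesis
    using that by (metis surjD)
qed

lemma card_power_fixed:
  fixes S :: "'a::field set"
  assumes "n > 1" and "\<And>x. x \<in> S \<Longrightarrow> x ^ n = x"
  shows "finite S" and "card S \<le> n"
proof -
  define p :: "'a poly" where "p = Polynomial.monom 1 n - Polynomial.monom 1 1"
  have deg: "Polynomial.degree p = n"
    unfolding p_def diff_conv_add_uminus using assms(1)
    by (subst degree_add_eq_left) (simp_all add: Polynomial.degree_monom_eq)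
  then have "p \<noteq> 0"
    using assms(1) by auto
  have sub: "S \<subseteq> {x. poly p x = 0}"
    using assms(2) by (auto simp: p_def poly_monom)
  show "finite S"
    using sub \<open>p \<noteq> 0\<close> poly_roots_finite finite_subset by blast
  show "card S \<le> n"
    using card_mono[OF poly_roots_finite[OF \<open>p \<noteq> 0\<close>] sub] card_poly_roots_bound[OF \<open>p \<noteq> 0\<close>] deg
    by simp
qed

lemma card_field_gt_1: "CARD('k::{field,finite}) > 1"
proof -
  have "card {0, 1::'k} \<le> CARD('k)"
    by (rule card_mono) auto
  then show ?thesis
    by simp
qed

text \<open>The polynomial \<open>X ^ q - X\<close> has at most \<open>q\<close> roots, and the
  image of the base field already supplies \<open>q\<close> of them.\<close>

lemma mem_Fq_iff: "(x :: 'k::{field,finite} alg_closure) \<in> Fq \<longleftrightarrow> x ^ CARD('k) = x"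
proof -
  have fin: "finite {x :: 'k alg_closure. x ^ CARD('k) = x}"
    "card {x :: 'k alg_closure. x ^ CARD('k) = x} \<le> CARD('k)"
    using card_power_fixed[OF card_field_gt_1, of "{x :: 'k alg_closure. x ^ CARD('k) = x}"] by auto
  have "Fq \<subseteq> {x :: 'k alg_closure. x ^ CARD('k) = x}"
    by (auto simp: Fq_def finite_field_power_card simp flip: to_ac_power)
  moreover have "card (Fq :: 'k alg_closure set) = CARD('k)"
    unfolding Fq_def by (simp add: card_image inj_to_ac)
  ultimately have "Fq = {x :: 'k alg_closure. x ^ CARD('k) = x}"
    using fin by (intro card_seteq) auto
  then show ?thesis
    by auto
qed

text \<open>Root counting gives the upper bound; equality follows in
  \<open>bij_betw_norm_coordinates\<close>, once a norm form exhibits \<open>q ^ 3\<close>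
  elements.\<close>

lemma finite_Fq3: "finite (Fq3 :: 'k::{field,finite} alg_closure set)"
  and card_Fq3_le: "card (Fq3 :: 'k::{field,finite} alg_closure set) \<le> CARD('k) ^ 3"
proof -
  have "CARD('k) ^ 3 > 1"
    using card_field_gt_1[where ?'k='k] by (intro one_less_power) auto
  then show "finite (Fq3 :: 'k alg_closure set)"
    "card (Fq3 :: 'k::{field,finite} alg_closure set) \<le> CARD('k) ^ 3"
    by (rule card_power_fixed; simp add: Fq3_def)+
qed

lemma frobenius_add:
  fixes x y :: "'k::{field,finite} alg_closure"
  assumes "(2::'k) = 0"
  shows "(x + y) ^ CARD('k) = x ^ CARD('k) + y ^ CARD('k)"
  using char2_card[OF assms] char2_power_add[OF char2_to_ac[OF assms]] by metis

lemma frobenius_to_ac: "to_ac (x :: 'k::{field,finite}) ^ CARD('k) = to_ac x"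
  by (metis finite_field_power_card to_ac_power)

subsection \<open>Polynomials over a finite field of characteristic two\<close>

lemma pderiv_square_char2:
  fixes p :: "'a::idom poly"
  assumes "(2::'a) = 0"
  shows "pderiv (p\<^sup>2) = 0"
  using assms by (simp add: pderiv_power)

text \<open>The field is perfect, so the part of \<open>p\<close> of even degree is a square and the
  part of odd degree is \<open>X\<close> times a square; the derivative retains only the
  latter.\<close>

lemma poly_square_decomposition:
  fixes p :: "'k::{field,finite} poly"
  assumes two: "(2::'k) = 0"
  obtains a b where "p = a\<^sup>2 + [:0, 1:] * b\<^sup>2" and "pderiv p = b\<^sup>2"
    and "2 * degree a \<le> degree p" and "b \<noteq> 0 \<Longrightarrow> 2 * degree b + 1 \<le> degree p"
proof -
  have "\<exists>a b. p = a\<^sup>2 + [:0, 1:] * b\<^sup>2 \<and> 2 * degree a \<le> degree p \<and>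
    (b \<noteq> 0 \<longrightarrow> 2 * degree b + 1 \<le> degree p)"
  proof (induction p)
    case 0
    show ?case
      by (intro exI[of _ 0]) simp
  next
    case (pCons c p)
    then obtain a b where ab: "p = a\<^sup>2 + [:0, 1:] * b\<^sup>2" "2 * degree a \<le> degree p"
      "b \<noteq> 0 \<longrightarrow> 2 * degree b + 1 \<le> degree p"
      by blast
    obtain r where r: "r\<^sup>2 = c"
      using finite_field_sqrt[OF two] .
    \<comment> \<open>Multiplication by \<open>X\<close> exchanges even and odd parts, so
      \<open>a\<close> and \<open>b\<close> swap roles.\<close>
    have "pCons c p = [:r:]\<^sup>2 + [:0, 1:] * p"
      by (simp add: power2_eq_square r[symmetric])
    also have "\<dots> = ([:r:] + [:0, 1:] * b)\<^sup>2 + [:0, 1:] * a\<^sup>2"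
      unfolding char2_square_add[OF char2_poly[OF two]] ab(1) power_mult_distrib
      by (simp only: power2_eq_square ring_distribs ac_simps)
    finally have eq: "pCons c p = ([:r:] + [:0, 1:] * b)\<^sup>2 + [:0, 1:] * a\<^sup>2" .
    have "2 * degree ([:r:] + [:0, 1:] * b) \<le> degree (pCons c p)"
    proof (cases "b = 0")
      case False
      then have "p \<noteq> 0"
        using ab(3) by force
      then show ?thesis
        using ab(3) False by (auto simp: degree_pCons_eq)
    qed simp
    moreover have "2 * degree a + 1 \<le> degree (pCons c p)" if "a \<noteq> 0"
    proof -
      have "p \<noteq> 0"
      proof
        assume "p = 0"
        then have "b = 0"
          using ab(3) by auto
        then show False
          using \<open>p = 0\<close> ab(1) that by simp
      qed
      then show ?thesis
        using ab(2) by simp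
    qed
    ultimately show ?case
      using eq by blast
  qed
  then obtain a b where ab: "p = a\<^sup>2 + [:0, 1:] * b\<^sup>2" "2 * degree a \<le> degree p"
    "b \<noteq> 0 \<Longrightarrow> 2 * degree b + 1 \<le> degree p"
    by blast
  moreover have "pderiv p = b\<^sup>2"
    unfolding ab(1) pderiv_add pderiv_mult pderiv_square_char2[OF two] by (simp add: pderiv_pCons)
  ultimately show ?thesis
    using that by blast
qed

text \<open>The remainder modulo \<open>X ^ q - X\<close> has degree below \<open>q\<close> and
  vanishes at \<open>q\<close> points.\<close>

lemma vanishing_poly_dvd:
  fixes G :: "'k::{field,finite} poly"
  assumes "\<And>x. poly G x = 0"
  shows "[:0, 1:] ^ CARD('k) - [:0, 1:] dvd G"
proof -
  define P :: "'k poly" where "P = [:0, 1:] ^ CARD('k) - [:0, 1:]"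
  have deg: "degree P = CARD('k)"
    unfolding P_def diff_conv_add_uminus using card_field_gt_1[where ?'k='k]
    by (subst degree_add_eq_left) (simp_all add: degree_power_eq)
  then have "P \<noteq> 0"
    by auto
  have "poly P x = 0" for x
    by (simp add: P_def finite_field_power_card)
  moreover have "poly G x = poly (G div P) x * poly P x + poly (G mod P) x" for x
    by (metis div_mult_mod_eq poly_add poly_mult)
  ultimately have "poly (G mod P) x = poly 0 x" for x
    using assms by simp
  moreover have "degree (G mod P) < CARD('k)"
    using degree_mod_less[OF \<open>P \<noteq> 0\<close>, of G] deg by auto
  ultimately have "G mod P = 0"
    using poly_eqI_degree[of UNIV "G mod P" 0] by auto
  then show ?thesis
    unfolding P_def[symmetric] by auto
qed

text \<open>A proper factorisation of a cubic has a linear factor, hence a root.\<close>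

lemma prime_elem_cubic:
  fixes d :: "'a::field poly"
  assumes "degree d = 3" and "\<And>x. poly d x \<noteq> 0"
  shows "prime_elem d"
proof (rule field_poly_irreducible_imp_prime, rule irreducibleI)
  show "d \<noteq> 0"
    using assms(1) by auto
  then show "\<not> d dvd 1"
    using assms(1) by (simp add: is_unit_iff_degree)
  fix a b
  assume ab: "d = a * b"
  then have nz: "a \<noteq> 0" "b \<noteq> 0"
    using \<open>d \<noteq> 0\<close> by auto
  have lin: "degree p \<noteq> 1" if "p dvd d" for p
  proof
    assume "degree p = 1"
    then obtain u v where p: "p = [:u, v:]" "v \<noteq> 0"
      by (metis degree1_coeffs)
    then have "poly p (- u / v) = 0"
      by simp
    then show False
      using \<open>p dvd d\<close> assms(2) by (metis dvdE mult_zero_left poly_mult)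
  qed
  have "degree a + degree b = 3"
    using assms(1) nz unfolding ab by (simp add: degree_mult_eq)
  moreover have "degree a \<noteq> 1" "degree b \<noteq> 1"
    using lin ab by auto
  ultimately have "degree a = 0 \<or> degree b = 0"
    by linarith
  then show "a dvd 1 \<or> b dvd 1"
    using nz by (auto simp: is_unit_iff_degree)
qed

section \<open>Artin-Schreier elements and their traces\<close>

lemma artin_schreier_telescope:
  fixes y :: "'a::comm_ring_1"
  assumes two: "(2::'a) = 0"
  shows "(\<Sum>i<n. (y\<^sup>2 + y) ^ (2 ^ i)) = y ^ (2 ^ n) + y"
proof (induction n)
  case (Suc n)
  have "(y\<^sup>2 + y) ^ (2 ^ n) = y ^ (2 ^ Suc n) + y ^ (2 ^ n)"
    by (simp add: char2_power_add[OF two] power_mult[symmetric])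
  then show ?case
    using Suc by (simp add: char2_simps[OF two] ac_simps)
qed (simp add: char2_simps[OF two])

lemma degree_le_imp_smult:
  fixes p d :: "'a::field poly"
  assumes "d dvd p" and "degree p \<le> degree d"
  obtains k where "p = smult k d"
proof -
  obtain r where r: "p = d * r"
    using assms(1) by blast
  show ?thesis
  proof (cases "p = 0")
    case True
    then show ?thesis
      using that[of 0] by simp
  next
    case False
    then have "degree r = 0"
      using assms(2) unfolding r by (auto simp: degree_mult_eq)
    then obtain k where "r = [:k:]"
      by (metis degree_eq_zeroE)
    then show ?thesis
      using that[of k] r by simp
  qed
qed

text \<open>
  If \<open>B / d\<close> has trace zero everywhere, then \<open>X ^ q + X\<close> divides
  \<open>G = (\<Sum>i. B ^ 2 ^ i * d ^ (q / 2 - 2 ^ i))\<close>. All terms of \<open>G\<close> but the first are squares, so the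
  derivative of \<open>G\<close> is a square \<open>(E * d ^ (q / 4 - 1))\<^sup>2\<close>, and comparing with the derivative of the
  product forces \<open>E * d ^ (q / 4 - 1)\<close> to have a gap between the degrees \<open>q / 4\<close> and \<open>q / 2\<close>.
\<close>

lemma artin_schreier_quotient_const:
  fixes d B :: "'k::{field,finite} poly"
  assumes two: "(2::'k) = 0" and card: "CARD('k) \<ge> 16"
    and deg: "degree d = 3" and noroot: "\<And>x. poly d x \<noteq> 0"
    and degB: "degree B \<le> 3"
    and as: "\<And>x. \<exists>y. poly B x = (y\<^sup>2 + y) * poly d x"
  obtains k where "B = smult k d"
proof -
  obtain H where H: "CARD('k) = 2 ^ H"
    using char2_card[OF two] .
  have "(2::nat) ^ 4 \<le> 2 ^ H"
    using card H by simp
  then have "4 \<le> H"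
    by (subst (asm) power_increasing_iff) auto
  define n where "n = H - 2"
  define Q :: nat where "Q = 2 ^ n"
  have n: "H = n + 2" "n \<ge> 2"
    using \<open>4 \<le> H\<close> by (auto simp: n_def)
  have q: "CARD('k) = 4 * Q"
    by (simp add: H n Q_def)
  have "(2::nat) ^ 2 \<le> 2 ^ n"
    using n by (intro power_increasing) auto
  then have Q4: "Q \<ge> 4"
    by (simp add: Q_def)
  note two' = char2_poly[OF two]
  note c2 = char2_simps[OF two']
  let ?X = "[:0, 1:] :: 'k poly"
  \<comment> \<open>\<open>G\<close> is the trace of \<open>B / d\<close> times
    \<open>d ^ (2 * Q)\<close>; the exponent \<open>2 * Q = 2 ^ (n + 1)\<close> just clears the last
    denominator.\<close>
  define G where "G = (\<Sum>i<n+2. B ^ (2 ^ i) * d ^ (2 * Q - 2 ^ i))"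
  have le: "2 ^ i \<le> 2 * Q" if "i < n + 2" for i
    using that power_increasing[of i "n + 1" "2::nat"] by (simp add: Q_def)
  have "poly G x = 0" for x
  proof -
    obtain y where y: "poly B x = (y\<^sup>2 + y) * poly d x"
      using as by blast
    have "poly G x = (\<Sum>i<n+2. (y\<^sup>2 + y) ^ (2 ^ i) * poly d x ^ (2 * Q))"
      unfolding G_def poly_sum
    proof (intro sum.cong refl)
      fix i
      assume "i \<in> {..<n + 2}"
      then have "poly d x ^ (2 * Q) = poly d x ^ (2 ^ i) * poly d x ^ (2 * Q - 2 ^ i)"
        using le by (simp flip: power_add)
      then show "poly (B ^ 2 ^ i * d ^ (2 * Q - 2 ^ i)) x = (y\<^sup>2 + y) ^ 2 ^ i * poly d x ^ (2 * Q)"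
        by (simp add: y power_mult_distrib)
    qed
    also have "\<dots> = (y ^ CARD('k) + y) * poly d x ^ (2 * Q)"
      unfolding sum_distrib_right[symmetric] artin_schreier_telescope[OF two] H n ..
    finally show ?thesis
      by (simp add: finite_field_power_card char2_simps[OF two])
  qed
  then obtain g where g: "G = (?X ^ CARD('k) + ?X) * g"
    using vanishing_poly_dvd[of G] by (auto simp: dvd_def c2)
  have degG: "degree G \<le> 6 * Q"
    unfolding G_def
  proof (rule degree_sum_le)
    fix i
    assume "i \<in> {..<n + 2}"
    then have "3 * 2 ^ i + 3 * (2 * Q - 2 ^ i) = 6 * Q"
      using le[of i] by auto
    moreover have "degree (B ^ (2 ^ i)) \<le> 3 * 2 ^ i"
      by (rule order_trans[OF degree_power_le]) (simp add: degB)
    moreover have "degree (d ^ (2 * Q - 2 ^ i)) \<le> 3 * (2 * Q - 2 ^ i)"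
      by (rule order_trans[OF degree_power_le]) (simp add: deg)
    ultimately show "degree (B ^ 2 ^ i * d ^ (2 * Q - 2 ^ i)) \<le> 6 * Q"
      using degree_mult_le[of "B ^ (2 ^ i)" "d ^ (2 * Q - 2 ^ i)"] by linarith
  qed simp
  have degP: "degree (?X ^ CARD('k) + ?X) = CARD('k)"
    using card by (subst degree_add_eq_left) (simp_all add: degree_power_eq)
  \<comment> \<open>The bound is \<open>6 * Q\<close> minus the degree \<open>4 * Q\<close> of
    \<open>X ^ q + X\<close>.\<close>
  have degg: "degree g \<le> 2 * Q"
  proof (cases "g = 0")
    case False
    have "?X ^ CARD('k) + ?X \<noteq> 0"
      using degP by (metis degree_0 zero_less_card_finite less_numeral_extra(3))
    then have "degree G = CARD('k) + degree g"
      unfolding g using False by (subst degree_mult_eq) (simp_all add: degP)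
    then show ?thesis
      using degG q by simp
  qed simp
  obtain a b where ab: "g = a\<^sup>2 + ?X * b\<^sup>2" "pderiv g = b\<^sup>2" "2 * degree a \<le> degree g"
    using poly_square_decomposition[OF two, of g] by metis
  obtain F E where FE: "B * d = F\<^sup>2 + ?X * E\<^sup>2" "pderiv (B * d) = E\<^sup>2"
    "E \<noteq> 0 \<Longrightarrow> 2 * degree E + 1 \<le> degree (B * d)"
    using poly_square_decomposition[OF two, of "B * d"] by metis
  have "degree (B * d) \<le> 6"
    using degree_mult_le[of B d] degB deg by linarith
  then have degE: "degree E \<le> 2"
    using FE(3) by (cases "E = 0") auto
  \<comment> \<open>The summands with \<open>i \<ge> 1\<close> are squares and have derivative zero;
    the first one is \<open>B * d\<close> times the square of \<open>d ^ (Q - 1)\<close>.\<close>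
  have "(E * d ^ (Q - 1))\<^sup>2 = pderiv G"
  proof -
    have "B ^ (2 ^ Suc i) * d ^ (2 * Q - 2 ^ Suc i) = (B ^ (2 ^ i) * d ^ (Q - 2 ^ i))\<^sup>2" for i
    proof -
      have "2 * Q - 2 ^ Suc i = (Q - 2 ^ i) * 2" "2 ^ Suc i = 2 ^ i * (2::nat)"
        by auto
      then show ?thesis
        unfolding power_mult_distrib power_mult[symmetric] by metis
    qed
    then have "G = B * d ^ (2 * Q - 1) + (\<Sum>i<Suc n. (B ^ (2 ^ i) * d ^ (Q - 2 ^ i))\<^sup>2)"
      unfolding G_def add_2_eq_Suc' sum.lessThan_Suc_shift[of _ "Suc n"] by simp
    also have "(\<Sum>i<Suc n. (B ^ (2 ^ i) * d ^ (Q - 2 ^ i))\<^sup>2) = (\<Sum>i<Suc n. B ^ (2 ^ i) * d ^ (Q - 2 ^ i))\<^sup>2"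
      using char2_power_sum[OF two', of _ "{..<Suc n}" 1] by (simp only: power_one_right)
    finally have "G = B * d ^ (2 * Q - 1) + (\<Sum>i<Suc n. B ^ (2 ^ i) * d ^ (Q - 2 ^ i))\<^sup>2" .
    then have "pderiv G = pderiv (B * d ^ (2 * Q - 1))"
      by (simp add: pderiv_add pderiv_square_char2[OF two])
    also have "B * d ^ (2 * Q - 1) = (B * d) * (d ^ (Q - 1))\<^sup>2"
    proof -
      have "2 * Q - 1 = Suc ((Q - 1) * 2)"
        using Q4 by simp
      then show ?thesis
        by (simp add: power_mult[symmetric])
    qed
    also have "pderiv \<dots> = E\<^sup>2 * (d ^ (Q - 1))\<^sup>2"
      unfolding pderiv_mult[of "B * d"] pderiv_square_char2[OF two] FE(2) by (simp add: mult.commute)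
    finally show ?thesis
      by (simp add: power_mult_distrib)
  qed
  \<comment> \<open>The same derivative from the product: \<open>X ^ q + X\<close> has derivative 1,
    and the terms \<open>X * b\<^sup>2\<close> cancel.\<close>
  also have "\<dots> = (a + ?X ^ (2 * Q) * b)\<^sup>2"
  proof -
    have Xq: "?X ^ CARD('k) = (?X ^ (2 * Q))\<^sup>2"
      by (simp add: q power_mult[symmetric])
    have "pderiv (?X ^ CARD('k) + ?X) = 1"
      unfolding Xq pderiv_add pderiv_square_char2[OF two] by (simp add: pderiv_pCons)
    then have "pderiv G = (?X ^ CARD('k) + ?X) * b\<^sup>2 + g"
      unfolding g pderiv_mult ab(2) by (simp add: mult.commute)
    also have "\<dots> = ?X ^ CARD('k) * b\<^sup>2 + a\<^sup>2"
      unfolding ab(1) distrib_right by (simp only: add.assoc add.left_commute[of "?X * _"] c2) (simp add: c2 ac_simps)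
    finally show ?thesis
      unfolding Xq char2_square_add[OF two'] power_mult_distrib by (simp add: add.commute)
  qed
  finally have "E * d ^ (Q - 1) = a + ?X ^ (2 * Q) * b"
    by (rule char2_square_inject[OF two'])
  \<comment> \<open>Multiplying by \<open>d\<close> makes the exponent a power of two, so that
    \<open>d ^ Q\<close> splits additively at degree \<open>2 * Q\<close>.\<close>
  then have "E * d ^ Q = a * d + ?X ^ (2 * Q) * (b * d)"
    using Q4 by (metis power_minus_mult less_le_trans zero_less_numeral distrib_right mult.assoc)
  moreover obtain d0 d1 d2 d3 where d: "d = [:d0, d1, d2, d3:]"
  proof -
    have "d = [:coeff d 0, coeff d 1, coeff d 2, coeff d 3:]"
      by (rule poly_eqI) (auto simp: deg coeff_pCons numeral_eq_Suc coeff_eq_0 split: nat.split)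
    then show ?thesis
      using that by blast
  qed
  have "d = [:d0, d1:] + ?X\<^sup>2 * [:d2, d3:]"
    by (simp add: d power2_eq_square)
  then have "d ^ Q = [:d0, d1:] ^ Q + ?X ^ (2 * Q) * [:d2, d3:] ^ Q"
    by (simp only: Q_def char2_power_add[OF two'] power_mult_distrib power_mult[symmetric])
  ultimately have "E * [:d0, d1:] ^ Q - a * d = ?X ^ (2 * Q) * (b * d - E * [:d2, d3:] ^ Q)"
    by (simp only: algebra_simps)
  then have eq: "E * [:d0, d1:] ^ Q + a * d = ?X ^ (2 * Q) * (b * d + E * [:d2, d3:] ^ Q)"
    by (simp only: c2)
  \<comment> \<open>The left side of \<open>eq\<close> has degree at most \<open>Q + 3\<close>,
    which is below \<open>2 * Q\<close> since \<open>Q \<ge> 4\<close>, while the right side is a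
    multiple of \<open>X ^ (2 * Q)\<close>; so both vanish.\<close>
  have "degree (E * [:d0, d1:] ^ Q + a * d) < 2 * Q"
  proof -
    have "degree ([:d0, d1:] ^ Q) \<le> Q"
      by (rule order_trans[OF degree_power_le]) simp
    then have "degree (E * [:d0, d1:] ^ Q) \<le> 2 + Q"
      using degree_mult_le[of E "[:d0, d1:] ^ Q"] degE by linarith
    moreover have "degree (a * d) \<le> Q + 3"
      using degree_mult_le[of a d] ab(3) degg deg by linarith
    ultimately have "degree (E * [:d0, d1:] ^ Q + a * d) \<le> Q + 3"
      by (intro degree_add_le) auto
    then show ?thesis
      using Q4 by linarith
  qed
  then have "E * [:d0, d1:] ^ Q + a * d = 0"
    unfolding eq by (cases "b * d + E * [:d2, d3:] ^ Q = 0") (simp_all add: degree_mult_eq degree_power_eq)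
  then have "d dvd E * [:d0, d1:] ^ Q"
    by (metis c2(3) add_eq_0_iff dvd_triv_right)
  moreover note prime = prime_elem_cubic[OF deg noroot]
  moreover have "\<not> d dvd [:d0, d1:]"
  proof
    assume *: "d dvd [:d0, d1:]"
    have "d0 \<noteq> 0"
      using noroot[of 0] d by simp
    then have "degree d \<le> degree [:d0, d1:]"
      using dvd_imp_degree_le[OF *] by simp
    then show False
      using deg by (simp split: if_splits)
  qed
  ultimately have "d dvd E"
    by (meson prime_elem_dvd_mult_iff prime_elem_dvd_power)
  then have "E = 0"
    using degE deg dvd_imp_degree_le[of d E] by force
  \<comment> \<open>The prime \<open>d\<close> divides \<open>F\<close>, so \<open>d\<^sup>2\<close>
    divides \<open>B * d\<close>.\<close>
  then have F: "B * d = F\<^sup>2"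
    using FE(1) by simp
  then have "d dvd F"
    using prime prime_elem_dvd_power by (metis dvd_triv_right)
  then obtain F' where "F = d * F'"
    by blast
  moreover have "d \<noteq> 0"
    using deg by auto
  ultimately have "B = d * F'\<^sup>2"
    using F by (simp add: power2_eq_square)
  then have "d dvd B"
    by simp
  then show ?thesis
    using degree_le_imp_smult[of d B] degB deg that by metis
qed

subsection \<open>Cubics without rational roots\<close>

lemmas semiring_normal = power2_eq_square power3_eq_cube distrib_left distrib_right mult.assoc
  mult.commute mult.left_commute add.assoc add.commute add.left_commute add_0_left add_0_right

lemma power_power_commute: "(x ^ m) ^ n = (x ^ n) ^ m" for x :: "'a::monoid_mult"
  by (simp add: power_mult[symmetric] mult.commute)

lemma char2_add_eq_0_iff:
  fixes x y :: "'a::comm_ring_1"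
  assumes "(2::'a) = 0"
  shows "x + y = 0 \<longleftrightarrow> x = y"
  using char2_simps(4)[OF assms] by (metis eq_iff_diff_eq_0)

lemma alg_closed_quadratic_root:
  fixes b c :: "'a::alg_closed_field"
  obtains x where "x\<^sup>2 + b * x + c = 0"
proof -
  have "degree [:c, b, 1:] > 0"
    by simp
  then obtain x where "poly [:c, b, 1:] x = 0"
    using alg_closed_imp_poly_has_root by blast
  then show ?thesis
    using that[of x] by (simp add: algebra_simps power2_eq_square)
qed

lemma alg_closed_cube_root:
  fixes c :: "'a::alg_closed_field"
  obtains x where "x ^ 3 = c"
proof -
  have "degree [:- c, 0, 0, 1:] > 0"
    by simp
  then obtain x where "poly [:- c, 0, 0, 1:] x = 0"
    using alg_closed_imp_poly_has_root by blast
  then show ?thesis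
    using that[of x] by (simp add: algebra_simps power3_eq_cube)
qed

lemma frobenius_cubic:
  fixes x :: "'k::{field,finite} alg_closure"
  assumes two: "(2::'k) = 0"
  shows "(x ^ 3 + to_ac c * x + to_ac d) ^ CARD('k) =
    (x ^ CARD('k)) ^ 3 + to_ac c * x ^ CARD('k) + to_ac d"
  by (simp only: frobenius_add[OF two] power_mult_distrib frobenius_to_ac power_power_commute[of x 3])

text \<open>The cubic has no quadratic term, so its roots sum to zero and the third one is
  \<open>t + t'\<close>; without a rational root the Frobenius must permute them cyclically.\<close>

lemma rootless_cubic_conjugates:
  fixes c d :: "'k::{field,finite}"
  assumes two: "(2::'k) = 0" and noroot: "\<And>s. s ^ 3 + c * s + d \<noteq> 0"
  obtains t t' where "t' = t ^ CARD('k)" and "t' ^ CARD('k) = t + t'"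
    and "to_ac c = t\<^sup>2 + t * t' + t'\<^sup>2" and "to_ac d = t * t' * (t + t')" and "t \<notin> Fq"
    and "t ^ 3 + to_ac c * t + to_ac d = 0"
proof -
  note two' = char2_to_ac[OF two]
  note c2 = char2_simps[OF two']
  have "degree [:to_ac d, to_ac c, 0, 1:] > 0"
    by simp
  then obtain t where "poly [:to_ac d, to_ac c, 0, 1:] t = 0"
    using alg_closed_imp_poly_has_root by blast
  then have t: "t ^ 3 + to_ac c * t + to_ac d = 0"
    by (simp add: algebra_simps power3_eq_cube)
  have irr: "u \<notin> Fq" if "u ^ 3 + to_ac c * u + to_ac d = 0" for u
  proof
    assume "u \<in> Fq"
    then obtain s where "u = to_ac s"
      by (auto simp: Fq_def)
    with that have "to_ac (s ^ 3 + c * s + d) = 0"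
      by simp
    then show False
      using noroot by (simp only: to_ac_eq_0_iff)
  qed
  define t' where "t' = t ^ CARD('k)"
  have "t' \<noteq> t"
    using irr[OF t] by (auto simp: mem_Fq_iff t'_def)
  have t': "t' ^ 3 + to_ac c * t' + to_ac d = 0"
    using frobenius_cubic[OF two, of t c d] t by (simp add: t'_def power_0_left)
  have "(t + t') * (t\<^sup>2 + t * t' + t'\<^sup>2 + to_ac c) =
    (t ^ 3 + to_ac c * t + to_ac d) + (t' ^ 3 + to_ac c * t' + to_ac d)"
    by (simp only: semiring_normal c2)
  moreover have sum_nz: "t + t' \<noteq> 0"
    using \<open>t' \<noteq> t\<close> by (metis c2(4) eq_iff_diff_eq_0)
  ultimately have "t\<^sup>2 + t * t' + t'\<^sup>2 + to_ac c = 0"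
    using t t' by simp
  then have c: "to_ac c = t\<^sup>2 + t * t' + t'\<^sup>2"
    by (metis c2(4) eq_iff_diff_eq_0)
  have "to_ac d = t ^ 3 + to_ac c * t"
    using t by (metis c2(4) eq_iff_diff_eq_0)
  then have d: "to_ac d = t * t' * (t + t')"
    unfolding c by (simp only: semiring_normal c2)
  define u where "u = t' ^ CARD('k)"
  have "to_ac c = (t\<^sup>2 + t * t' + t'\<^sup>2) ^ CARD('k)"
    unfolding c[symmetric] by (simp add: frobenius_to_ac)
  also have "\<dots> = t'\<^sup>2 + t' * u + u\<^sup>2"
    by (simp only: frobenius_add[OF two] power_mult_distrib u_def t'_def power_power_commute[of _ 2])
  finally have c': "to_ac c = t'\<^sup>2 + t' * u + u\<^sup>2" .
  have "(t + u) * (t + t' + u) = (t\<^sup>2 + t * t' + t'\<^sup>2) + (t'\<^sup>2 + t' * u + u\<^sup>2)"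
    by (simp only: semiring_normal c2)
  then have "t + u = 0 \<or> t + t' + u = 0"
    unfolding c[symmetric] c'[symmetric] by (simp add: c2)
  \<comment> \<open>If the Frobenius exchanged \<open>t\<close> and \<open>t'\<close>, it would fix
    the third root \<open>t + t'\<close>.\<close>
  moreover have "t + u \<noteq> 0"
  proof
    assume "t + u = 0"
    then have "u = t"
      by (metis c2(4) eq_iff_diff_eq_0)
    then have "(t + t') ^ CARD('k) = t + t'"
      by (simp add: frobenius_add[OF two] t'_def[symmetric] u_def[symmetric] add.commute)
    moreover have "(t + t') ^ 3 + to_ac c * (t + t') + to_ac d = 0"
      unfolding c d by (simp only: semiring_normal c2)
    ultimately show False
      using irr mem_Fq_iff by blast
  qed
  ultimately have "u = t + t'"
    by (metis c2(4) eq_iff_diff_eq_0)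
  then show ?thesis
    using that[of t' t] t'_def u_def c d irr[OF t] t by simp
qed

text \<open>
  The Berlekamp discriminant: the Frobenius acts on the roots of a rootless cubic by an even
  permutation.
\<close>

lemma rootless_cubic_discriminant:
  fixes c d :: "'k::{field,finite}"
  assumes two: "(2::'k) = 0" and noroot: "\<And>s. s ^ 3 + c * s + d \<noteq> 0"
  obtains u where "(u\<^sup>2 + u) * d\<^sup>2 = c ^ 3 + d\<^sup>2"
proof -
  note two' = char2_to_ac[OF two]
  note c2 = char2_simps[OF two']
  obtain t t' where t': "t' = t ^ CARD('k)" "t' ^ CARD('k) = t + t'"
    and c: "to_ac c = t\<^sup>2 + t * t' + t'\<^sup>2" and d: "to_ac d = t * t' * (t + t')"
    using rootless_cubic_conjugates[OF two noroot] by metis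
  \<comment> \<open>With \<open>t'' = t + t'\<close> this is
    \<open>t\<^sup>2 * t' + t'\<^sup>2 * t'' + t''\<^sup>2 * t\<close>, which is invariant under
    cyclic permutations of the roots. Odd permutations send it to \<open>p + d\<close>, and
    \<open>p * (p + d) = c ^ 3 + d\<^sup>2\<close>.\<close>
  define p where "p = t ^ 3 + t\<^sup>2 * t' + t' ^ 3"
  have "p ^ CARD('k) = t' ^ 3 + t'\<^sup>2 * (t + t') + (t + t') ^ 3"
    unfolding p_def t'(2)[symmetric]
    by (simp only: frobenius_add[OF two] power_mult_distrib t'(1) power_power_commute[of _ 2]
        power_power_commute[of _ 3])
  also have "\<dots> = p"
    unfolding p_def by (simp only: semiring_normal c2)
  finally obtain v where v: "p = to_ac v"
    using mem_Fq_iff by (metis Fq_def rangeE)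
  have "to_ac (v\<^sup>2 + v * d) = to_ac (c ^ 3 + d\<^sup>2)"
    unfolding to_ac_add to_ac_mult to_ac_power v[symmetric] c d p_def
    by (simp only: semiring_normal c2)
  then have v: "v\<^sup>2 + v * d = c ^ 3 + d\<^sup>2"
    by (simp only: to_ac_eq_iff)
  have "d \<noteq> 0"
    using noroot[of 0] by auto
  then have "((v / d)\<^sup>2 + v / d) * d\<^sup>2 = v\<^sup>2 + v * d"
    by (simp add: power2_eq_square field_simps)
  then show ?thesis
    using that[of "v / d"] v by simp
qed

section \<open>Power sums and cubic residue symbols\<close>

lemma sum_power_finite_field:
  assumes "i < CARD('k) - 1"
  shows "(\<Sum>x\<in>(UNIV :: 'k::{field,finite} set). x ^ i) = 0"
proof -
  \<comment> \<open>Otherwise all \<open>q\<close> elements are roots of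
    \<open>X ^ (i + 1) - X\<close>, whose degree is less than \<open>q\<close>.\<close>
  have "\<exists>g::'k. g \<noteq> 0 \<and> g ^ i \<noteq> 1" if "i > 0"
  proof (rule ccontr)
    assume *: "\<nexists>g::'k. g \<noteq> 0 \<and> g ^ i \<noteq> 1"
    have "x ^ Suc i = x" for x :: 'k
      using * by (cases "x = 0") auto
    then have "CARD('k) \<le> Suc i"
      using card_power_fixed(2)[of "Suc i" "UNIV :: 'k set"] that by auto
    then show False
      using assms by simp
  qed
  moreover have "(\<Sum>x\<in>(UNIV :: 'k set). x ^ i) = 0" if "g \<noteq> 0" "g ^ i \<noteq> 1" for g :: 'k
  proof -
    have "(\<Sum>x\<in>(UNIV :: 'k set). x ^ i) = (\<Sum>x\<in>UNIV. (g * x) ^ i)"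
      by (rule sum.reindex_bij_witness[of _ "\<lambda>y. g * y" "\<lambda>y. y / g"]) (use that in auto)
    also have "\<dots> = g ^ i * (\<Sum>x\<in>UNIV. x ^ i)"
      by (simp add: power_mult_distrib sum_distrib_left)
    finally have "(g ^ i - 1) * (\<Sum>x\<in>(UNIV :: 'k set). x ^ i) = 0"
      by (simp add: algebra_simps)
    then show ?thesis
      using that by simp
  qed
  \<comment> \<open>Translation by 1 preserves the sum of all elements, so \<open>q\<close> is zero
    in the field.\<close>
  moreover have "(\<Sum>x\<in>(UNIV :: 'k set). x ^ 0) = 0"
  proof -
    have "(\<Sum>x\<in>(UNIV :: 'k set). x) = (\<Sum>x\<in>UNIV. x + 1)"
      by (rule sum.reindex_bij_witness[of _ "\<lambda>y. y + 1" "\<lambda>y. y - 1"]) auto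
    then show ?thesis
      by (simp add: sum.distrib)
  qed
  ultimately show ?thesis
    by (cases "i = 0") auto
qed

text \<open>The power sums with exponent below \<open>q - 1\<close> vanish and the one with exponent
  \<open>q - 1\<close> is -1.\<close>

lemma sum_poly_finite_field:
  fixes p :: "'k::{field,finite} poly"
  assumes "degree p \<le> CARD('k) - 1"
  shows "(\<Sum>x\<in>UNIV. poly p x) = - coeff p (CARD('k) - 1)"
proof -
  define m where "m = CARD('k) - 1"
  have m: "CARD('k) = Suc m" "m > 0"
    using card_field_gt_1[where ?'k='k] by (auto simp: m_def)
  have pow: "x ^ m = (if x = 0 then 0 else 1)" for x :: 'k
  proof -
    have "x * x ^ m = x"
      using finite_field_power_card[of x] m by simp
    then show ?thesis
      using m by auto
  qed
  have "of_nat CARD('k) = (0::'k)"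
    using sum_power_finite_field[of 0, where ?'k='k] m by simp
  then have "of_nat m = (-1::'k)"
    unfolding m(1) by (simp add: eq_neg_iff_add_eq_0 add.commute)
  moreover have "(\<Sum>x\<in>(UNIV :: 'k set). x ^ m) = of_nat m"
    unfolding pow by (simp add: sum.If_cases m_def card_Diff_singleton Compl_eq_Diff_UNIV)
  ultimately have sm: "(\<Sum>x\<in>(UNIV :: 'k set). x ^ m) = -1"
    by simp
  have "poly p x = (\<Sum>i\<le>m. coeff p i * x ^ i)" for x
  proof -
    have "(\<Sum>i\<le>m. coeff p i * x ^ i) = (\<Sum>i\<le>degree p. coeff p i * x ^ i)"
      by (rule sum.mono_neutral_right) (use assms in \<open>auto simp: m_def coeff_eq_0\<close>)
    then show ?thesis
      by (simp add: poly_altdef)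
  qed
  then have "(\<Sum>x\<in>UNIV. poly p x) = (\<Sum>i\<le>m. coeff p i * (\<Sum>x\<in>UNIV. x ^ i))"
    by (simp add: sum_distrib_left) (rule sum.swap)
  also have "\<dots> = coeff p m * (\<Sum>x\<in>UNIV. x ^ m) + (\<Sum>i<m. coeff p i * (\<Sum>x\<in>UNIV. x ^ i))"
    unfolding lessThan_Suc_atMost[symmetric] sum.lessThan_Suc by (rule add.commute)
  also have "(\<Sum>i<m. coeff p i * (\<Sum>x\<in>(UNIV :: 'k set). x ^ i)) = 0"
    by (rule sum.neutral) (auto simp: sum_power_finite_field m)
  finally show ?thesis
    unfolding sm m_def[symmetric] by simp
qed

text \<open>
  The cubic \<open>s\<^sup>3 + d\<close> always has a zero: otherwise the cubic residue symbols \<open>d(x) ^ n\<close> are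
  primitive cube roots of unity, whose sum lies in the prime field but equals the symbol of the
  leading coefficient.
\<close>

lemma pure_cubic_isotropic:
  fixes d :: "'k::{field,finite} poly"
  assumes two: "(2::'k) = 0" and deg: "degree d = 3"
    and noroot: "\<And>s x. s ^ 3 + poly d x \<noteq> 0" and lead: "\<And>s. s ^ 3 + coeff d 3 \<noteq> 0"
  shows False
proof -
  note c2 = char2_simps[OF two]
  \<comment> \<open>For \<open>s ^ 3 + coeff d 3\<close> the discriminant condition says that the
    field contains a primitive cube root of unity.\<close>
  have "\<exists>u::'k. u\<^sup>2 + u + 1 = 0"
  proof -
    obtain u where "(u\<^sup>2 + u) * (coeff d 3)\<^sup>2 = 0 ^ 3 + (coeff d 3)\<^sup>2"
      using rootless_cubic_discriminant[OF two, of 0 "coeff d 3"] lead by auto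
    then have "(u\<^sup>2 + u) * (coeff d 3)\<^sup>2 = 1 * (coeff d 3)\<^sup>2"
      by simp
    moreover have "coeff d 3 \<noteq> 0"
      using lead[of 0] by auto
    ultimately have "u\<^sup>2 + u = 1"
      by (simp only: mult_cancel_right) simp
    then show ?thesis
      using c2 by metis
  qed
  then obtain u :: 'k where u: "u\<^sup>2 + u + 1 = 0"
    by blast
  have u3: "u ^ 3 = 1"
  proof -
    have "u ^ 3 + 1 = (u + 1) * (u\<^sup>2 + u + 1)"
      by (simp only: semiring_normal mult_1_left mult_1_right c2)
    then show ?thesis
      using u c2 by (metis mult_zero_right eq_iff_diff_eq_0)
  qed
  \<comment> \<open>Since \<open>u ^ 3 = 1\<close> and \<open>u ^ q = u\<close>, a residue 0 would
    give \<open>u = 1\<close> and a residue 2 would give \<open>u = u\<^sup>2\<close>.\<close>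
  have "CARD('k) mod 3 = 1"
  proof -
    obtain h where h: "CARD('k) = 2 ^ h"
      using char2_card[OF two] .
    have pow: "u = u ^ (CARD('k) mod 3)"
    proof -
      have "u ^ CARD('k) = u ^ (3 * (CARD('k) div 3) + CARD('k) mod 3)"
        by simp
      also have "\<dots> = u ^ (CARD('k) mod 3)"
        unfolding power_add power_mult u3 by simp
      finally show ?thesis
        by (simp add: finite_field_power_card)
    qed
    have "CARD('k) mod 3 \<noteq> 0"
    proof
      assume "CARD('k) mod 3 = 0"
      then have "u = 1"
        using pow by simp
      then show False
        using u two by simp
    qed
    moreover have "CARD('k) mod 3 \<noteq> 2"
    proof
      assume "CARD('k) mod 3 = 2"
      then have "u = u\<^sup>2"
        using pow by simp
      then show False
        using u c2 by (metis add_0 zero_neq_one)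
    qed
    ultimately show ?thesis
      by (metis mod_less_divisor[of 3] less_Suc_eq numeral_3_eq_3 numeral_2_eq_2 One_nat_def
          less_Suc0 zero_less_numeral)
  qed
  define n where "n = CARD('k) div 3"
  have n: "CARD('k) = 3 * n + 1"
    using \<open>CARD('k) mod 3 = 1\<close> div_mult_mod_eq[of "CARD('k)" 3] by (simp add: n_def)
  have omega: "(e ^ n)\<^sup>2 + e ^ n = 1" if e: "\<And>s. s ^ 3 + e \<noteq> 0" for e :: 'k
  proof -
    have "e \<noteq> 0"
      using e[of 0] by auto
    moreover have "e * e ^ (3 * n) = e"
      using finite_field_power_card[of e] n by simp
    ultimately have "(e ^ n) ^ 3 = 1"
      by (simp add: power_mult[symmetric] mult.commute)
    moreover have "e ^ n \<noteq> 1"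
    proof
      assume 1: "e ^ n = 1"
      \<comment> \<open>A cube root \<open>t\<close> of \<open>e\<close> in the closure satisfies
        \<open>t ^ q = t * e ^ n = t\<close>, so it would be rational.\<close>
      obtain t where t: "t ^ 3 = to_ac e"
        using alg_closed_cube_root .
      have "t ^ CARD('k) = t * (t ^ 3) ^ n"
        unfolding n by (simp add: power_mult[symmetric])
      also have "\<dots> = t"
        unfolding t to_ac_power[symmetric] 1 by simp
      finally obtain s where "t = to_ac s"
        using mem_Fq_iff by (metis Fq_def rangeE)
      then have "s ^ 3 = e"
        using t by (metis to_ac_eq_iff to_ac_power)
      then show False
        using e[of s] c2 by simp
    qed
    moreover have "(e ^ n + 1) * ((e ^ n)\<^sup>2 + e ^ n + 1) = (e ^ n) ^ 3 + 1"
      by (simp only: semiring_normal mult_1_left mult_1_right c2)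
    ultimately have "(e ^ n)\<^sup>2 + e ^ n + 1 = 0"
      using c2 by (metis mult_eq_0_iff eq_iff_diff_eq_0)
    then show ?thesis
      using c2 by (metis eq_iff_diff_eq_0)
  qed
  \<comment> \<open>As \<open>3 * n = q - 1\<close>, the sum over the field extracts exactly the
    leading coefficient of \<open>d ^ n\<close>.\<close>
  have degn: "degree (d ^ n) = CARD('k) - 1"
    using deg n by (subst degree_power_eq) auto
  then have "(\<Sum>x\<in>UNIV. poly (d ^ n) x) = - lead_coeff (d ^ n)"
    by (subst sum_poly_finite_field) simp_all
  then have S: "(\<Sum>x\<in>UNIV. poly d x ^ n) = coeff d 3 ^ n"
    by (simp add: lead_coeff_power deg c2)
  \<comment> \<open>For the sum \<open>S\<close> of all symbols, \<open>S\<^sup>2 + S\<close> is a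
    sum of \<open>q\<close> ones and hence 0; but \<open>S\<close> is the symbol of the leading
    coefficient, for which the value is 1.\<close>
  have "(\<Sum>x\<in>UNIV. poly d x ^ n)\<^sup>2 + (\<Sum>x\<in>UNIV. poly d x ^ n) = (\<Sum>x\<in>UNIV. (poly d x ^ n)\<^sup>2 + poly d x ^ n)"
    using char2_power_sum[OF two, of "\<lambda>x. poly d x ^ n" UNIV 1] by (simp add: sum.distrib)
  also have "\<dots> = (\<Sum>x\<in>(UNIV::'k set). x ^ 0)"
    by (rule sum.cong) (auto simp: omega noroot)
  also have "\<dots> = 0"
    using card_field_gt_1[where ?'k='k] by (intro sum_power_finite_field) auto
  finally show False
    unfolding S using omega lead by simp
qed

subsection \<open>Anisotropic ternary cubics\<close>

text \<open>Squaring is injective modulo the prime \<open>d\<close>, hence surjective on the finite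
  set of residues.\<close>

lemma square_root_mod_cubic:
  fixes d p :: "'k::{field,finite} poly"
  assumes two: "(2::'k) = 0" and prime: "prime_elem d" and deg: "degree d = 3"
  obtains v where "degree v < 3" and "d dvd p + v\<^sup>2"
proof -
  note two' = char2_poly[OF two]
  note c2 = char2_simps[OF two']
  define S :: "'k poly set" where "S = {v. degree v < 3}"
  have "S \<subseteq> range (\<lambda>(a, b, c). [:a, b, c:])"
  proof
    fix v :: "'k poly"
    assume "v \<in> S"
    then have "v = [:coeff v 0, coeff v 1, coeff v 2:]"
      unfolding S_def
      by (intro poly_eqI) (auto simp: coeff_pCons numeral_eq_Suc coeff_eq_0 split: nat.split)
    then show "v \<in> range (\<lambda>(a, b, c). [:a, b, c:])"
      by (metis (mono_tags, lifting) case_prod_conv rangeI)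
  qed
  then have fin: "finite S"
    by (rule finite_subset) simp
  have "d \<noteq> 0"
    using deg by auto
  then have modS: "r mod d \<in> S" for r
    using degree_mod_less[of d r] deg by (auto simp: S_def)
  have "inj_on (\<lambda>v. v\<^sup>2 mod d) S"
  proof (rule inj_onI)
    fix v w
    assume vw: "v \<in> S" "w \<in> S" "v\<^sup>2 mod d = w\<^sup>2 mod d"
    then have "d dvd (v + w)\<^sup>2"
      unfolding char2_square_add[OF two'] by (metis c2(4) mod_eq_dvd_iff)
    then have "d dvd v + w"
      using prime prime_elem_dvd_power by blast
    moreover have "degree (v + w) < 3"
      using vw by (auto simp: S_def intro: degree_add_less)
    ultimately have "v + w = 0"
      using deg dvd_imp_degree_le by force
    then show "v = w"
      by (simp add: char2_add_eq_0_iff[OF two'])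
  qed
  moreover have "(\<lambda>v. v\<^sup>2 mod d) ` S \<subseteq> S"
    using modS by blast
  ultimately have "(\<lambda>v. v\<^sup>2 mod d) ` S = S"
    by (intro endo_inj_surj fin)
  then obtain v where v: "v \<in> S" "v\<^sup>2 mod d = p mod d"
    using modS[of p] by (metis (mono_tags, lifting) imageE)
  then have "d dvd p + v\<^sup>2"
    by (metis c2(4) mod_eq_dvd_iff)
  then show ?thesis
    using v that by (simp add: S_def)
qed

lemma smult_conv_mult: "smult k p = [:k:] * p"
  by simp

text \<open>By coprimality a root of \<open>p\<close> has the same multiplicity in \<open>p\<close>
  as in \<open>c ^ 3\<close>, a multiple of three; degree at most three leaves room for one root
  only.\<close>

lemma cube_of_coprime_factor:
  fixes p r c :: "'a::alg_closed_field poly"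
  assumes pr: "p * r = c ^ 3" and "c \<noteq> 0" and deg: "degree p \<le> 3"
    and cop: "\<And>x. poly p x = 0 \<Longrightarrow> poly r x \<noteq> 0"
  obtains m where "p = m ^ 3" and "degree m \<le> 1"
proof -
  have nz: "p \<noteq> 0" "r \<noteq> 0"
    using pr \<open>c \<noteq> 0\<close> by auto
  show ?thesis
  proof (cases "degree p = 0")
    case True
    then obtain e where e: "p = [:e:]"
      by (metis degree_eq_zeroE)
    obtain t where "t ^ 3 = e"
      using alg_closed_cube_root .
    then have "p = [:t:] ^ 3"
      by (simp add: e power3_eq_cube mult.assoc)
    then show ?thesis
      using that[of "[:t:]"] by simp
  next
    case False
    then obtain x where x: "poly p x = 0"
      using alg_closed_imp_poly_has_root[of p] by auto
    have "order x p + order x r = order x (c ^ 3)"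
      using order_mult[of p r x] nz by (simp add: pr[symmetric])
    also have "\<dots> = 3 * order x c"
      using \<open>c \<noteq> 0\<close> by (simp add: power3_eq_cube order_mult)
    finally have "order x p = 3 * order x c"
      using order_root[of r x] cop[OF x] by auto
    moreover have "order x p \<noteq> 0"
      using order_root[of p x] x nz by auto
    ultimately have "3 \<le> order x p"
      by simp
    then have "[:- x, 1:] ^ 3 dvd p"
      using order_divides by blast
    moreover have "degree ([:- x, 1:] ^ 3) = 3"
      by (simp add: degree_power_eq)
    ultimately obtain e where e: "p = smult e ([:- x, 1:] ^ 3)"
      using degree_le_imp_smult[of "[:- x, 1:] ^ 3" p] deg by metis
    obtain t where "t ^ 3 = e"
      using alg_closed_cube_root .
    then have "p = (smult t [:- x, 1:]) ^ 3"
      unfolding e smult_power by simp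
    moreover have "degree (smult t [:- x, 1:]) \<le> 1"
      by simp
    ultimately show ?thesis
      using that by blast
  qed
qed

section \<open>Base change of polynomials to the algebraic closure\<close>

abbreviation map_ac :: "'k::field poly \<Rightarrow> 'k alg_closure poly" where
  "map_ac \<equiv> map_poly to_ac"

lemma map_ac_add: "map_ac (p + q) = map_ac p + map_ac q"
  by (rule poly_eqI) (simp add: coeff_map_poly)

lemma map_ac_mult: "map_ac (p * q) = map_ac p * map_ac q"
  by (rule poly_eqI) (simp add: coeff_map_poly coeff_mult to_ac_sum)

lemma map_ac_power: "map_ac (p ^ n) = map_ac p ^ n"
  by (induction n) (simp_all add: map_ac_mult)

lemma map_ac_smult: "map_ac (smult k p) = smult (to_ac k) (map_ac p)"
  by (rule poly_eqI) (simp add: coeff_map_poly)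

text \<open>Euclidean descent: a common root passes on to \<open>d mod c\<close>, which is nonzero
  by primality of \<open>d\<close>, until a nonzero constant is reached.\<close>

lemma prime_elem_no_common_root:
  fixes c d :: "'k::field poly"
  assumes "prime_elem d" and "c \<noteq> 0" and "degree c < degree d" and "poly (map_ac d) x = 0"
  shows "poly (map_ac c) x \<noteq> 0"
  using assms(2,3)
proof (induction "degree c" arbitrary: c rule: less_induct)
  case less
  show ?case
  proof
    assume c: "poly (map_ac c) x = 0"
    show False
    proof (cases "degree c = 0")
      case True
      then obtain e where "c = [:e:]"
        by (metis degree_eq_zeroE)
      then show False
        using less.prems c by (simp add: map_poly_pCons)
    next
      case False
      have "map_ac d = map_ac (d div c) * map_ac c + map_ac (d mod c)"
        by (metis div_mult_mod_eq map_ac_add map_ac_mult)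
      then have root: "poly (map_ac (d mod c)) x = 0"
        using c assms(4) by (metis add_0 mult_zero_right poly_add poly_mult)
      show False
      proof (cases "d mod c = 0")
        case True
        then obtain e where e: "d = c * e"
          by (metis dvd_eq_mod_eq_0 dvdE)
        then have "d dvd c \<or> d dvd e"
          using assms(1) by (metis dvd_refl prime_elem_dvd_mult_iff)
        moreover have "\<not> d dvd c"
          using less.prems dvd_imp_degree_le[of d c] by auto
        moreover have "\<not> d dvd e"
        proof
          assume "d dvd e"
          moreover have "e \<noteq> 0"
            using e assms(1) by auto
          ultimately have "degree d \<le> degree e"
            by (simp add: dvd_imp_degree_le)
          then show False
            using e \<open>e \<noteq> 0\<close> less.prems(1) False by (simp add: degree_mult_eq)
        qed
        ultimately show False
          by blast
      next
        case nz: False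
        have "degree (d mod c) < degree c"
          using degree_mod_less[OF less.prems(1), of d] nz by simp
        then show False
          using less.hyps[of "d mod c"] nz less.prems root by simp
      qed
    qed
  qed
qed

text \<open>
  The Artin--Schreier condition on all lines through a point turns into
  \<open>c\<^sup>3 = v\<^sup>2 + v d + k d\<^sup>2\<close>; the right-hand side factors over the closure into two coprime
  cubics, which must therefore be cubes.
\<close>

lemma depressed_cubic_sum_of_cubes:
  fixes c d :: "'k::{field,finite} poly"
  assumes two: "(2::'k) = 0" and card: "CARD('k) \<ge> 16"
    and degc: "degree c \<le> 2" and degd: "degree d = 3"
    and noroot: "\<And>s x. s ^ 3 + poly c x * s + poly d x \<noteq> 0"
    and lead: "\<And>s. s ^ 3 + coeff c 2 * s + coeff d 3 \<noteq> 0"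
  obtains m0 m1 n0 n1 where "map_ac c = [:m0, m1:] * [:n0, n1:]"
    and "map_ac d = [:m0, m1:] ^ 3 + [:n0, n1:] ^ 3"
proof -
  note two_p = char2_poly[OF two]
  note c2 = char2_simps[OF two_p]
  note two' = char2_to_ac[OF two]
  note two'_p = char2_poly[OF two']
  note c2' = char2_simps[OF two'_p]
  have d0: "poly d x \<noteq> 0" for x
    using noroot[of 0 x] by simp
  note prime = prime_elem_cubic[OF degd d0]
  \<comment> \<open>For \<open>c = 0\<close> the cubic would be pure and hence have a zero.\<close>
  have "c \<noteq> 0"
    using pure_cubic_isotropic[OF two degd] noroot lead by auto
  obtain v where v: "degree v < 3" "d dvd c ^ 3 + v\<^sup>2"
    using square_root_mod_cubic[OF two prime degd] .
  then obtain B' where B': "c ^ 3 + v\<^sup>2 = d * B'"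
    by blast
  then have c3: "c ^ 3 = v\<^sup>2 + d * B'"
    by (metis add.commute c2(2))
  have "d \<noteq> 0"
    using degd by auto
  have degB': "degree B' \<le> 3"
  proof (cases "B' = 0")
    case False
    have "degree (c ^ 3) \<le> 6"
      using degree_power_le[of c 3] degc by simp
    moreover have "degree (v\<^sup>2) \<le> 6"
      using degree_power_le[of v 2] v(1) by simp
    ultimately have "degree (d * B') \<le> 6"
      unfolding B'[symmetric] by (rule degree_add_le)
    then show ?thesis
      using False \<open>d \<noteq> 0\<close> degd by (simp add: degree_mult_eq)
  qed simp
  \<comment> \<open>By \<open>c3\<close>, the sum of \<open>c ^ 3 / d\<^sup>2 + 1\<close> and
    \<open>B / d\<close> is the Artin-Schreier element \<open>(v / d)\<^sup>2 + v / d\<close>; so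
    \<open>B / d\<close> is of this form at every point too.\<close>
  define B where "B = v + B' + d"
  have "degree B \<le> 3"
    unfolding B_def using v(1) degB' degd by (intro degree_add_le) auto
  moreover have "\<exists>y. poly B x = (y\<^sup>2 + y) * poly d x" for x
  proof -
    obtain u where u: "(u\<^sup>2 + u) * (poly d x)\<^sup>2 = poly c x ^ 3 + (poly d x)\<^sup>2"
      using rootless_cubic_discriminant[OF two, of "poly c x" "poly d x"] noroot by blast
    have "poly c x ^ 3 = (poly v x)\<^sup>2 + poly d x * poly B' x"
      using arg_cong[OF c3, of "\<lambda>p. poly p x"] by simp
    then have u': "(u\<^sup>2 + u) * (poly d x)\<^sup>2 = (poly v x)\<^sup>2 + poly d x * poly B' x + (poly d x)\<^sup>2"
      using u by simp
    let ?y = "u + poly v x / poly d x"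
    have "(?y\<^sup>2 + ?y) * (poly d x)\<^sup>2 = (u\<^sup>2 + u) * (poly d x)\<^sup>2 + (poly v x)\<^sup>2 + poly v x * poly d x"
      unfolding char2_square_add[OF two] using d0[of x] by (simp add: field_simps power2_eq_square)
    also have "\<dots> = poly B x * poly d x"
      unfolding u' B_def poly_add by (simp only: semiring_normal char2_simps[OF two])
    finally have "poly B x = (?y\<^sup>2 + ?y) * poly d x"
      using d0[of x] by (simp add: power2_eq_square)
    then show ?thesis
      by blast
  qed
  ultimately obtain k where "B = smult k d"
    using artin_schreier_quotient_const[OF two card degd d0] by metis
  then have "B' = v + smult (k + 1) d"
    unfolding B_def by (simp add: smult_add_left) (metis c2(2) add.assoc add.commute)
  then have "c ^ 3 = v\<^sup>2 + v * d + smult (k + 1) (d\<^sup>2)"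
    unfolding c3 by (simp add: distrib_left power2_eq_square mult.commute add.assoc)
  then have cub: "map_ac c ^ 3 = (map_ac v)\<^sup>2 + map_ac v * map_ac d + smult (to_ac (k + 1)) ((map_ac d)\<^sup>2)"
    by (metis map_ac_add map_ac_mult map_ac_power map_ac_smult)
  \<comment> \<open>This root factors the right-hand side as
    \<open>(v + \<kappa> * d) * (v + (\<kappa> + 1) * d)\<close>.\<close>
  obtain \<kappa> where "\<kappa>\<^sup>2 + 1 * \<kappa> + to_ac (k + 1) = 0"
    using alg_closed_quadratic_root .
  then have \<kappa>: "to_ac (k + 1) = \<kappa>\<^sup>2 + \<kappa>"
    by (simp only: char2_add_eq_0_iff[OF two'] mult_1_left)
  define P where "P = map_ac v + smult \<kappa> (map_ac d)"
  define R where "R = P + map_ac d"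
  have PR: "P * R = map_ac c ^ 3"
    unfolding cub \<kappa> R_def P_def smult_add_left power2_eq_square[of \<kappa>] smult_smult[symmetric]
    by (simp only: smult_conv_mult semiring_normal c2')
  have nz: "map_ac c \<noteq> 0"
    using \<open>c \<noteq> 0\<close> by (simp add: map_poly_eq_0_iff)
  have deg_ac: "degree (map_ac w) = degree w" for w :: "'k poly"
    by (simp add: degree_map_poly)
  \<comment> \<open>A common root of \<open>P\<close> and \<open>R\<close> would be one of
    \<open>c\<close> and \<open>d\<close>.\<close>
  have cop: "poly P x \<noteq> 0 \<or> poly R x \<noteq> 0" for x
  proof (rule ccontr)
    assume "\<not> (poly P x \<noteq> 0 \<or> poly R x \<noteq> 0)"
    then have *: "poly P x = 0" "poly R x = 0"
      by auto
    then have "poly (map_ac d) x = 0"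
      by (simp add: R_def)
    moreover have "poly (map_ac c) x = 0"
      using arg_cong[OF PR, of "\<lambda>p. poly p x"] * by simp
    ultimately show False
      using prime_elem_no_common_root[OF prime \<open>c \<noteq> 0\<close>] degc degd by simp
  qed
  have degP: "degree P \<le> 3"
    unfolding P_def using v(1) degd degree_smult_le[of \<kappa> "map_ac d"]
    by (intro degree_add_le) (auto simp: deg_ac)
  then have degR: "degree R \<le> 3"
    unfolding R_def using degd by (intro degree_add_le) (auto simp: deg_ac)
  obtain m where m: "P = m ^ 3" "degree m \<le> 1"
    using cube_of_coprime_factor[OF PR nz degP] cop by blast
  obtain n where n: "R = n ^ 3" "degree n \<le> 1"
    using cube_of_coprime_factor[of R P "map_ac c"] PR nz degR cop by (metis mult.commute)
  have dm: "map_ac d = m ^ 3 + n ^ 3"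
    using m(1) n(1) R_def by (metis c2'(2))
  obtain \<omega> :: "'k alg_closure" where "\<omega>\<^sup>2 + 1 * \<omega> + 1 = 0"
    using alg_closed_quadratic_root .
  then have \<omega>: "\<omega>\<^sup>2 = \<omega> + 1"
    by (simp add: add.assoc char2_add_eq_0_iff[OF two'])
  have \<omega>2: "\<omega> * \<omega> = \<omega> + 1"
    using \<omega> by (simp add: power2_eq_square)
  have \<omega>2': "\<omega> * (\<omega> * x) = \<omega> * x + x" for x
    by (simp add: \<omega>2 mult.assoc[symmetric] distrib_right)
  \<comment> \<open>Equal cubes determine \<open>c\<close> only up to a cube root of unity
    \<open>e\<close>; absorbing \<open>e\<close> into \<open>m\<close> leaves \<open>m ^ 3\<close>
    unchanged.\<close>
  have "\<exists>e. e ^ 3 = 1 \<and> map_ac c = smult e (m * n)"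
  proof -
    define A where "A = m * n"
    define C where "C = map_ac c"
    have "A ^ 3 = C ^ 3"
      using PR unfolding m(1) n(1) A_def C_def by (simp add: power_mult_distrib)
    then have "A ^ 3 + C ^ 3 = 0"
      using char2_add_eq_0_iff[OF two'_p] by blast
    moreover have "A ^ 3 + C ^ 3 = (C + A) * (C + smult \<omega> A) * (C + smult (\<omega> + 1) A)"
    proof -
      have w: "[:\<omega>:] * [:\<omega>:] = [:\<omega>:] + 1"
        by (simp add: \<omega>2 one_pCons)
      have w': "[:\<omega>:] * ([:\<omega>:] * x) = [:\<omega>:] * x + x" for x
        unfolding mult.assoc[symmetric] w by (simp add: distrib_right)
      show ?thesis
        unfolding smult_add_left smult_1_left
        by (simp only: smult_conv_mult semiring_normal w w' mult_1_left mult_1_right c2')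
    qed
    ultimately have "C + A = 0 \<or> C + smult \<omega> A = 0 \<or> C + smult (\<omega> + 1) A = 0"
      by auto
    then have "C = smult 1 A \<or> C = smult \<omega> A \<or> C = smult (\<omega> + 1) A"
      unfolding char2_add_eq_0_iff[OF two'_p] by simp
    moreover have "\<omega> ^ 3 = 1" "(\<omega> + 1) ^ 3 = 1"
      by (simp_all only: semiring_normal mult_1_left mult_1_right \<omega>2 \<omega>2' char2_simps[OF two'])
    ultimately show ?thesis
      unfolding A_def C_def by (metis power_one)
  qed
  then obtain e where e: "e ^ 3 = 1" "map_ac c = smult e m * n"
    by auto
  have lin: "\<exists>a b. w = [:a, b:]" if "degree w \<le> 1" for w :: "'k alg_closure poly"
  proof -
    have "w = [:coeff w 0, coeff w 1:]"
      using that by (intro poly_eqI) (auto simp: coeff_pCons numeral_eq_Suc coeff_eq_0 split: nat.split)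
    then show ?thesis
      by blast
  qed
  have "degree (smult e m) \<le> 1"
    using degree_smult_le[of e m] m(2) by simp
  then obtain m0 m1 where mm: "smult e m = [:m0, m1:]"
    using lin by blast
  obtain n0 n1 where nn: "n = [:n0, n1:]"
    using lin n(2) by blast
  have "map_ac d = (smult e m) ^ 3 + n ^ 3"
    using dm e(1) by (simp add: smult_power)
  then show ?thesis
    using that e(2) mm nn by simp
qed

section \<open>Frobenius action on the linear factors\<close>

lemma frobenius_three_cycle:
  fixes a b c :: "'k::{field,finite} alg_closure"
  assumes two: "(2::'k) = 0" and sum: "c = a + b" and "b \<notin> Fq" and "c \<notin> Fq"
    and "a ^ CARD('k) = b" and "b ^ CARD('k) \<in> {a, b, c}"
  shows "b ^ CARD('k) = c" and "c ^ CARD('k) = a"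
proof -
  note c2 = char2_simps[OF char2_to_ac[OF two]]
  have "b ^ CARD('k) \<noteq> b"
    using \<open>b \<notin> Fq\<close> by (simp add: mem_Fq_iff)
  \<comment> \<open>If \<open>a\<close> and \<open>b\<close> were exchanged, their sum
    \<open>c\<close> would be fixed.\<close>
  moreover have "b ^ CARD('k) \<noteq> a"
  proof
    assume "b ^ CARD('k) = a"
    then have "c ^ CARD('k) = c"
      unfolding sum frobenius_add[OF two] assms(5) by (simp add: add.commute)
    then show False
      using \<open>c \<notin> Fq\<close> by (simp add: mem_Fq_iff)
  qed
  ultimately show *: "b ^ CARD('k) = c"
    using assms(6) by simp
  have "c ^ CARD('k) = b + c"
    unfolding sum frobenius_add[OF two] assms(5) *[unfolded sum] ..
  then show "c ^ CARD('k) = a"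
    unfolding sum by (simp only: semiring_normal c2)
qed

lemma N3_three_cycle:
  fixes a b c :: "'k::{field,finite} alg_closure"
  assumes "a ^ CARD('k) = b" and "b ^ CARD('k) = c" and "c ^ CARD('k) = a"
  shows "a \<in> Fq3" and "N3 a = a * b * c"
proof -
  have *: "a ^ (CARD('k) ^ 2) = c"
    by (simp add: power2_eq_square power_mult assms)
  then show "N3 a = a * b * c"
    by (simp add: N3_def assms)
  have "a ^ (CARD('k) ^ 3) = (a ^ (CARD('k) ^ 2)) ^ CARD('k)"
    by (simp add: power2_eq_square power3_eq_cube power_mult)
  then show "a \<in> Fq3"
    by (simp add: Fq3_def * assms)
qed

text \<open>The linear forms \<open>M\<close> and \<open>N\<close> split the cubic over the closure
  as in Cardano's formula. No factor has a rational zero apart from the origin, so the Frobenius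
  permutes the three factors cyclically and the cubic is the norm of one of them.\<close>

lemma depressed_cubic_norm:
  fixes c0 c1 c2 d0 d1 d2 d3 :: "'k::{field,finite}"
  assumes two: "(2::'k) = 0" and card: "CARD('k) \<ge> 16"
    and aniso: "\<And>s y z. s ^ 3 + (c2 * y\<^sup>2 + c1 * y * z + c0 * z\<^sup>2) * s +
      (d3 * y ^ 3 + d2 * y\<^sup>2 * z + d1 * y * z\<^sup>2 + d0 * z ^ 3) = 0 \<Longrightarrow> s = 0 \<and> y = 0 \<and> z = 0"
  obtains \<alpha> \<beta> where "\<And>s y z. to_ac s + \<alpha> * to_ac y + \<beta> * to_ac z \<in> Fq3"
    and "\<And>s y z. N3 (to_ac s + \<alpha> * to_ac y + \<beta> * to_ac z) =
      to_ac (s ^ 3 + (c2 * y\<^sup>2 + c1 * y * z + c0 * z\<^sup>2) * s +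
        (d3 * y ^ 3 + d2 * y\<^sup>2 * z + d1 * y * z\<^sup>2 + d0 * z ^ 3))"
proof -
  note two' = char2_to_ac[OF two]
  note c2' = char2_simps[OF two']
  define cf where "cf y z = c2 * y\<^sup>2 + c1 * y * z + c0 * z\<^sup>2" for y z
  define df where "df y z = d3 * y ^ 3 + d2 * y\<^sup>2 * z + d1 * y * z\<^sup>2 + d0 * z ^ 3" for y z
  note aniso = aniso[folded cf_def df_def]
  \<comment> \<open>These are the forms at \<open>z = 1\<close>; the points with
    \<open>z = 0\<close> supply the condition on leading coefficients.\<close>
  define c where "c = [:c0, c1, c2:]"
  define d where "d = [:d0, d1, d2, d3:]"
  have "d3 \<noteq> 0"
    using aniso[of 0 1 0] by (auto simp: df_def)
  have "degree c \<le> 2"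
    by (simp add: c_def)
  moreover have "degree d = 3"
    using \<open>d3 \<noteq> 0\<close> by (simp add: d_def)
  moreover have "s ^ 3 + poly c x * s + poly d x \<noteq> 0" for s x
  proof -
    have "poly c x = cf x 1" "poly d x = df x 1"
      by (simp_all add: c_def d_def cf_def df_def algebra_simps power2_eq_square power3_eq_cube)
    then show ?thesis
      using aniso[of s x 1] by auto
  qed
  moreover have "s ^ 3 + coeff c 2 * s + coeff d 3 \<noteq> 0" for s
  proof -
    have "coeff c 2 = cf 1 0" "coeff d 3 = df 1 0"
      by (simp_all add: c_def d_def cf_def df_def numeral_eq_Suc)
    then show ?thesis
      using aniso[of s 1 0] by auto
  qed
  ultimately obtain m0 m1 n0 n1 where mn: "map_ac c = [:m0, m1:] * [:n0, n1:]"
    "map_ac d = [:m0, m1:] ^ 3 + [:n0, n1:] ^ 3"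
    using depressed_cubic_sum_of_cubes[OF two card] by metis
  define M where "M y z = m1 * to_ac y + m0 * to_ac z" for y z
  define N where "N y z = n1 * to_ac y + n0 * to_ac z" for y z
  have cMN: "to_ac (cf y z) = M y z * N y z" for y z
  proof -
    have "to_ac c0 = m0 * n0" "to_ac c1 = m0 * n1 + m1 * n0" "to_ac c2 = m1 * n1"
      using mn(1) by (simp_all add: c_def map_poly_pCons mult.commute)
    then show ?thesis
      unfolding cf_def M_def N_def to_ac_add to_ac_mult to_ac_power by (simp only: semiring_normal)
  qed
  have dMN: "to_ac (df y z) = M y z ^ 3 + N y z ^ 3" for y z
  proof -
    have "[:m0, m1:] ^ 3 + [:n0, n1:] ^ 3 = [:m0 ^ 3 + n0 ^ 3, m0\<^sup>2 * m1 + n0\<^sup>2 * n1,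
      m0 * m1\<^sup>2 + n0 * n1\<^sup>2, m1 ^ 3 + n1 ^ 3:]"
      unfolding power3_eq_cube power2_eq_square
      by (simp, intro conjI; simp only: semiring_normal c2' two' mult_zero_left)
    then have "to_ac d0 = m0 ^ 3 + n0 ^ 3" "to_ac d1 = m0\<^sup>2 * m1 + n0\<^sup>2 * n1"
      "to_ac d2 = m0 * m1\<^sup>2 + n0 * n1\<^sup>2" "to_ac d3 = m1 ^ 3 + n1 ^ 3"
      using mn(2) by (simp_all add: d_def map_poly_pCons)
    then show ?thesis
      unfolding df_def M_def N_def to_ac_add to_ac_mult to_ac_power by (simp only: semiring_normal c2')
  qed
  obtain \<omega> :: "'k alg_closure" where "\<omega>\<^sup>2 + 1 * \<omega> + 1 = 0"
    using alg_closed_quadratic_root .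
  then have \<omega>: "\<omega> * \<omega> = \<omega> + 1"
    by (simp add: add.assoc char2_add_eq_0_iff[OF two'] power2_eq_square)
  have \<omega>': "\<omega> * (\<omega> * x) = \<omega> * x + x" for x
    by (simp add: \<omega> mult.assoc[symmetric] distrib_right)
  \<comment> \<open>The three forms are \<open>\<omega> ^ i * M + \<omega> ^ (2 * i) * N\<close> for
    i = 0, 1, 2, with \<open>\<omega>\<^sup>2 = \<omega> + 1\<close>.\<close>
  define \<mu>1 where "\<mu>1 y z = M y z + N y z" for y z
  define \<mu>2 where "\<mu>2 y z = \<omega> * M y z + (\<omega> + 1) * N y z" for y z
  define \<mu>3 where "\<mu>3 y z = (\<omega> + 1) * M y z + \<omega> * N y z" for y z
  note \<mu>_defs = \<mu>1_def \<mu>2_def \<mu>3_def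
  have fact: "x ^ 3 + to_ac (cf y z) * x + to_ac (df y z) = (x + \<mu>1 y z) * (x + \<mu>2 y z) * (x + \<mu>3 y z)"
    for x y z
    unfolding cMN dMN \<mu>_defs
    by (simp only: semiring_normal mult_1_left mult_1_right \<omega> \<omega>' c2')
  have sums: "\<mu>1 y z = \<mu>2 y z + \<mu>3 y z" "\<mu>2 y z = \<mu>1 y z + \<mu>3 y z" "\<mu>3 y z = \<mu>1 y z + \<mu>2 y z" for y z
    unfolding \<mu>_defs by (simp_all only: semiring_normal mult_1_left mult_1_right c2')
  have zero: "\<mu>1 0 0 = 0" "\<mu>2 0 0 = 0" "\<mu>3 0 0 = 0"
    by (simp_all add: \<mu>_defs M_def N_def)
  have irr: "\<mu>1 y z \<notin> Fq" "\<mu>2 y z \<notin> Fq" "\<mu>3 y z \<notin> Fq" if "y \<noteq> 0 \<or> z \<noteq> 0" for y z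
  proof -
    have "x \<notin> Fq" if "x ^ 3 + to_ac (cf y z) * x + to_ac (df y z) = 0" for x
    proof
      assume "x \<in> Fq"
      then obtain s where "x = to_ac s"
        by (auto simp: Fq_def)
      with that have "to_ac (s ^ 3 + cf y z * s + df y z) = 0"
        by simp
      then have "s ^ 3 + cf y z * s + df y z = 0"
        by (simp only: to_ac_eq_0_iff)
      then show False
        using aniso \<open>y \<noteq> 0 \<or> z \<noteq> 0\<close> by blast
    qed
    then show "\<mu>1 y z \<notin> Fq" "\<mu>2 y z \<notin> Fq" "\<mu>3 y z \<notin> Fq"
      unfolding fact by (simp_all add: c2')
  qed
  have perm: "x ^ CARD('k) \<in> {\<mu>1 y z, \<mu>2 y z, \<mu>3 y z}" if "x \<in> {\<mu>1 y z, \<mu>2 y z, \<mu>3 y z}" for x y z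
  proof -
    have "x ^ 3 + to_ac (cf y z) * x + to_ac (df y z) = 0"
      using that unfolding fact by (auto simp: c2')
    then have "(x ^ CARD('k)) ^ 3 + to_ac (cf y z) * x ^ CARD('k) + to_ac (df y z) = 0"
      unfolding frobenius_cubic[OF two, symmetric] by (simp add: power_0_left)
    then show ?thesis
      unfolding fact by (simp add: char2_add_eq_0_iff[OF two'])
  qed
  have add: "\<mu>1 (y + y') (z + z') = \<mu>1 y z + \<mu>1 y' z'" "\<mu>2 (y + y') (z + z') = \<mu>2 y z + \<mu>2 y' z'"
    "\<mu>3 (y + y') (z + z') = \<mu>3 y z + \<mu>3 y' z'" for y y' z z'
    by (simp_all add: \<mu>_defs M_def N_def algebra_simps)
  \<comment> \<open>The image of \<open>\<mu>1\<close> is the same factor at all points: the points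
    of either kind form an additive subgroup, and a group is not the union of two proper
    subgroups.\<close>
  have swap: "(\<forall>y z. \<mu>1 y z ^ CARD('k) = \<mu>2 y z) \<or> (\<forall>y z. \<mu>1 y z ^ CARD('k) = \<mu>3 y z)"
  proof (rule ccontr)
    assume "\<not> ?thesis"
    then obtain y z y' z' where ne: "\<mu>1 y z ^ CARD('k) \<noteq> \<mu>2 y z" "\<mu>1 y' z' ^ CARD('k) \<noteq> \<mu>3 y' z'"
      by blast
    have or: "\<mu>1 y z ^ CARD('k) = \<mu>2 y z \<or> \<mu>1 y z ^ CARD('k) = \<mu>3 y z" for y z
    proof (cases "y = 0 \<and> z = 0")
      case True
      then show ?thesis
        using zero by (simp add: power_0_left)
    next
      case False
      then show ?thesis
        using perm[of "\<mu>1 y z" y z] irr[of y z] by (auto simp: mem_Fq_iff)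
    qed
    have "\<mu>1 y z ^ CARD('k) = \<mu>3 y z" "\<mu>1 y' z' ^ CARD('k) = \<mu>2 y' z'"
      using or ne by blast+
    then have "\<mu>3 y z + \<mu>2 y' z' = \<mu>2 y z + \<mu>2 y' z' \<or> \<mu>3 y z + \<mu>2 y' z' = \<mu>3 y z + \<mu>3 y' z'"
      using or[of "y + y'" "z + z'"] unfolding add frobenius_add[OF two] by simp
    then show False
      using ne \<open>\<mu>1 y z ^ CARD('k) = \<mu>3 y z\<close> \<open>\<mu>1 y' z' ^ CARD('k) = \<mu>2 y' z'\<close> by auto
  qed
  have cyc: "to_ac s + \<mu>1 y z \<in> Fq3 \<and> N3 (to_ac s + \<mu>1 y z) = to_ac (s ^ 3 + cf y z * s + df y z)" for s y z
  proof -
    have shift: "(to_ac s + x) ^ CARD('k) = to_ac s + x ^ CARD('k)" for x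
      by (simp add: frobenius_add[OF two] frobenius_to_ac)
    have prod: "to_ac (s ^ 3 + cf y z * s + df y z) =
      (to_ac s + \<mu>1 y z) * (to_ac s + \<mu>2 y z) * (to_ac s + \<mu>3 y z)"
      unfolding fact[symmetric] by simp
    consider "\<mu>1 y z ^ CARD('k) = \<mu>2 y z" | "\<mu>1 y z ^ CARD('k) = \<mu>3 y z"
      using swap by blast
    then show ?thesis
    proof cases
      case 1
      have "\<mu>2 y z ^ CARD('k) = \<mu>3 y z \<and> \<mu>3 y z ^ CARD('k) = \<mu>1 y z"
      proof (cases "y = 0 \<and> z = 0")
        case False
        then show ?thesis
          using frobenius_three_cycle[OF two sums(3) _ _ 1] irr[of y z] perm[of "\<mu>2 y z" y z] by auto
      qed (auto simp: zero power_0_left)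
      then show ?thesis
        using N3_three_cycle[of "to_ac s + \<mu>1 y z" "to_ac s + \<mu>2 y z" "to_ac s + \<mu>3 y z"] 1
        unfolding prod by (simp add: shift)
    next
      case 2
      have "\<mu>3 y z ^ CARD('k) = \<mu>2 y z \<and> \<mu>2 y z ^ CARD('k) = \<mu>1 y z"
      proof (cases "y = 0 \<and> z = 0")
        case False
        then show ?thesis
          using frobenius_three_cycle[OF two sums(2) _ _ 2] irr[of y z] perm[of "\<mu>3 y z" y z] by auto
      qed (auto simp: zero power_0_left)
      then show ?thesis
        using N3_three_cycle[of "to_ac s + \<mu>1 y z" "to_ac s + \<mu>3 y z" "to_ac s + \<mu>2 y z"] 2
        unfolding prod by (simp add: shift mult.assoc mult.commute[of "to_ac s + \<mu>3 y z"])
    qed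
  qed
  have eq: "to_ac s + (m1 + n1) * to_ac y + (m0 + n0) * to_ac z = to_ac s + \<mu>1 y z" for s y z
    by (simp add: \<mu>1_def M_def N_def algebra_simps)
  show ?thesis
  proof (rule that[of "m1 + n1" "m0 + n0"])
    fix s y z
    show "to_ac s + (m1 + n1) * to_ac y + (m0 + n0) * to_ac z \<in> Fq3"
      unfolding eq using cyc by blast
    show "N3 (to_ac s + (m1 + n1) * to_ac y + (m0 + n0) * to_ac z) =
      to_ac (s ^ 3 + (c2 * y\<^sup>2 + c1 * y * z + c0 * z\<^sup>2) * s +
        (d3 * y ^ 3 + d2 * y\<^sup>2 * z + d1 * y * z\<^sup>2 + d0 * z ^ 3))"
      unfolding eq using cyc[of s y z, unfolded cf_def df_def] by blast
  qed
qed

text \<open>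
  In characteristic two the linear substitution \<open>x = s + \<kappa> y + \<iota> z\<close> removes the monomials
  \<open>x\<^sup>2 y\<close> and \<open>x\<^sup>2 z\<close>.
\<close>

lemma anisotropic_cubic_norm:
  fixes a1 a2 a3 b1 b2 b3 c1 c2 c3 e :: "'k::{field,finite}"
  assumes two: "(2::'k) = 0" and card: "CARD('k) \<ge> 16"
    and C_def: "\<And>x y z. C x y z = x * (a3 * x\<^sup>2 + b3 * y\<^sup>2 + c3 * z\<^sup>2 + e * y * z) +
      y * (a2 * x\<^sup>2 + b2 * y\<^sup>2 + c2 * z\<^sup>2 + e * x * z) +
      z * (a1 * x\<^sup>2 + b1 * y\<^sup>2 + c1 * z\<^sup>2 + e * x * y)"
    and aniso: "\<And>x y z. C x y z = 0 \<Longrightarrow> x = 0 \<and> y = 0 \<and> z = 0"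
  obtains \<alpha> \<beta> where "\<And>x y z. to_ac x + \<alpha> * to_ac y + \<beta> * to_ac z \<in> Fq3"
    and "\<And>x y z. to_ac (C x y z) = to_ac a3 * N3 (to_ac x + \<alpha> * to_ac y + \<beta> * to_ac z)"
proof -
  note c2s = char2_simps[OF two]
  have "a3 \<noteq> 0"
    using aniso[of 1 0 0] by (auto simp: C_def)
  \<comment> \<open>In characteristic two \<open>(x + \<kappa> * y + \<iota> * z) ^ 3\<close>
    contains \<open>\<kappa> * x\<^sup>2 * y\<close> and \<open>\<iota> * x\<^sup>2 * z\<close>,
    which match the coefficients \<open>a2\<close> and \<open>a1\<close>.\<close>
  define \<kappa> \<iota> where "\<kappa> = a2 / a3" and "\<iota> = a1 / a3"
  define B3 C3 E B2 C2 B1 C1 where "B3 = b3 / a3" and "C3 = c3 / a3" and "E = e / a3"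
    and "B2 = b2 / a3" and "C2 = c2 / a3" and "B1 = b1 / a3" and "C1 = c1 / a3"
  have coef: "a2 = a3 * \<kappa>" "a1 = a3 * \<iota>" "b3 = a3 * B3" "c3 = a3 * C3" "e = a3 * E" "b2 = a3 * B2"
    "c2 = a3 * C2" "b1 = a3 * B1" "c1 = a3 * C1"
    using \<open>a3 \<noteq> 0\<close> by (simp_all add: \<kappa>_def \<iota>_def B3_def C3_def E_def B2_def C2_def B1_def C1_def)
  define p2 p1 p0 where "p2 = \<kappa>\<^sup>2 + B3" and "p1 = E" and "p0 = \<iota>\<^sup>2 + C3"
  define r3 r2 r1 r0 where "r3 = B3 * \<kappa> + B2" and "r2 = B3 * \<iota> + E * \<kappa> + B1"
    and "r1 = C3 * \<kappa> + E * \<iota> + C2" and "r0 = C3 * \<iota> + C1"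
  define D where "D s y z = s ^ 3 + (p2 * y\<^sup>2 + p1 * y * z + p0 * z\<^sup>2) * s +
      (r3 * y ^ 3 + r2 * y\<^sup>2 * z + r1 * y * z\<^sup>2 + r0 * z ^ 3)" for s y z
  have CD: "C x y z = a3 * D (x + \<kappa> * y + \<iota> * z) y z" for x y z
    unfolding C_def D_def coef p2_def p1_def p0_def r3_def r2_def r1_def r0_def
    by (simp only: semiring_normal c2s)
  have "s = 0 \<and> y = 0 \<and> z = 0" if "D s y z = 0" for s y z
  proof -
    have "s + \<kappa> * y + \<iota> * z + \<kappa> * y + \<iota> * z = s"
      by (simp only: semiring_normal c2s)
    then have "C (s + \<kappa> * y + \<iota> * z) y z = 0"
      by (simp only: CD that mult_zero_right)
    then have *: "s + \<kappa> * y + \<iota> * z = 0 \<and> y = 0 \<and> z = 0"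
      by (rule aniso)
    then show ?thesis
      by auto
  qed
  then obtain \<alpha> \<beta> where ab: "\<And>s y z. to_ac s + \<alpha> * to_ac y + \<beta> * to_ac z \<in> Fq3"
    "\<And>s y z. N3 (to_ac s + \<alpha> * to_ac y + \<beta> * to_ac z) = to_ac (D s y z)"
    unfolding D_def using depressed_cubic_norm[OF two card] by metis
  have eq: "to_ac x + (to_ac \<kappa> + \<alpha>) * to_ac y + (to_ac \<iota> + \<beta>) * to_ac z =
    to_ac (x + \<kappa> * y + \<iota> * z) + \<alpha> * to_ac y + \<beta> * to_ac z" for x y z
    by (simp add: algebra_simps)
  show ?thesis
  proof (rule that[of "to_ac \<kappa> + \<alpha>" "to_ac \<iota> + \<beta>"])
    fix x y z
    show "to_ac x + (to_ac \<kappa> + \<alpha>) * to_ac y + (to_ac \<iota> + \<beta>) * to_ac z \<in> Fq3"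
      unfolding eq by (rule ab)
    show "to_ac (C x y z) = to_ac a3 * N3 (to_ac x + (to_ac \<kappa> + \<alpha>) * to_ac y + (to_ac \<iota> + \<beta>) * to_ac z)"
      unfolding eq ab(2) CD by simp
  qed
qed

subsection \<open>From ovoids to anisotropic cubics\<close>

text \<open>The second conclusion keeps the information that the degree is exactly two; for
  \<open>f1\<close> it rules out odd characteristic later.\<close>

lemma eval3_quadratic:
  fixes f :: "'k::comm_ring_1 poly3"
  assumes deg: "total_degree3 f = 2" and zero: "eval3 f 0 0 0 = 0"
  obtains a b c d e g l m n
  where "\<And>x y z. eval3 f x y z =
      a * x\<^sup>2 + b * y\<^sup>2 + c * z\<^sup>2 + d * y * z + e * x * z + g * x * y + l * x + m * y + n * z"
    and "\<not> (a = 0 \<and> b = 0 \<and> c = 0 \<and> d = 0 \<and> e = 0 \<and> g = 0)"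
proof -
  define A where "A = Poly_Mapping.lookup f"
  define T :: "(nat \<times> nat \<times> nat) set" where "T = {(0,0,0), (1,0,0), (0,1,0), (0,0,1),
    (2,0,0), (0,2,0), (0,0,2), (0,1,1), (1,0,1), (1,1,0)}"
  let ?D = "insert 0 ((\<lambda>(i, j, k). i + j + k) ` Poly_Mapping.keys f)"
  have fin: "finite ?D"
    by simp
  have keys: "Poly_Mapping.keys f \<subseteq> T"
  proof
    fix u
    assume u: "u \<in> Poly_Mapping.keys f"
    obtain i j k where ijk: "u = (i, j, k)"
      by (cases u)
    have "i + j + k \<in> ?D"
      using u ijk by force
    then have "i + j + k \<le> 2"
      using Max_ge[OF fin] deg unfolding total_degree3_def by metis
    moreover from this have "i = 0 \<or> i = 1 \<or> i = 2" "j = 0 \<or> j = 1 \<or> j = 2" "k = 0 \<or> k = 1 \<or> k = 2"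
      by linarith+
    ultimately show "u \<in> T"
      by (elim disjE) (simp_all add: T_def ijk)
  qed
  have ev: "eval3 f x y z = (\<Sum>(i, j, k)\<in>T. A (i, j, k) * x ^ i * y ^ j * z ^ k)" for x y z
    unfolding eval3_def A_def
    by (rule sum.mono_neutral_left) (use keys in \<open>auto simp: T_def Poly_Mapping.in_keys_iff\<close>)
  have ev': "eval3 f x y z = A (0,0,0) + A (2,0,0) * x\<^sup>2 + A (0,2,0) * y\<^sup>2 + A (0,0,2) * z\<^sup>2 +
    A (0,1,1) * y * z + A (1,0,1) * x * z + A (1,1,0) * x * y + A (1,0,0) * x + A (0,1,0) * y + A (0,0,1) * z"
    for x y z
    unfolding ev T_def by (simp add: algebra_simps)
  then have "A (0,0,0) = 0"
    using zero by simp
  then have "eval3 f x y z = A (2,0,0) * x\<^sup>2 + A (0,2,0) * y\<^sup>2 + A (0,0,2) * z\<^sup>2 +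
    A (0,1,1) * y * z + A (1,0,1) * x * z + A (1,1,0) * x * y + A (1,0,0) * x + A (0,1,0) * y + A (0,0,1) * z"
    for x y z
    unfolding ev' by simp
  moreover have "\<not> (A (2,0,0) = 0 \<and> A (0,2,0) = 0 \<and> A (0,0,2) = 0 \<and> A (0,1,1) = 0 \<and>
    A (1,0,1) = 0 \<and> A (1,1,0) = 0)"
  proof -
    have "2 \<in> ?D"
      using Max_in[OF fin] deg unfolding total_degree3_def by auto
    then obtain i j k where ijk: "(i, j, k) \<in> Poly_Mapping.keys f" "i + j + k = 2"
      by auto
    have "(i, j, k) \<in> T"
      using keys ijk(1) by blast
    then have "(i, j, k) \<in> {(2,0,0), (0,2,0), (0,0,2), (0,1,1), (1,0,1), (1,1,0)}"
      unfolding T_def by (elim insertE emptyE) (use ijk(2) in simp_all)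
    moreover have "A (i, j, k) \<noteq> 0"
      using ijk by (simp add: A_def Poly_Mapping.in_keys_iff)
    ultimately show ?thesis
      by auto
  qed
  ultimately show ?thesis
    using that by blast
qed

section \<open>Coordinates and orthogonality on the quadric\<close>

lemma UNIV_8: "(UNIV :: 8 set) = {0, 1, 2, 3, 4, 5, 6, 7}"
proof -
  have "card {0, 1, 2, 3, 4, 5, 6, 7 :: 8} = 8"
    by simp
  then show ?thesis
    by (intro card_subset_eq[symmetric]) auto
qed

lemma vec8_nth [simp]:
  "vec8 a0 a1 a2 a3 a4 a5 a6 a7 $ 0 = a0" "vec8 a0 a1 a2 a3 a4 a5 a6 a7 $ 1 = a1"
  "vec8 a0 a1 a2 a3 a4 a5 a6 a7 $ 2 = a2" "vec8 a0 a1 a2 a3 a4 a5 a6 a7 $ 3 = a3"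
  "vec8 a0 a1 a2 a3 a4 a5 a6 a7 $ 4 = a4" "vec8 a0 a1 a2 a3 a4 a5 a6 a7 $ 5 = a5"
  "vec8 a0 a1 a2 a3 a4 a5 a6 a7 $ 6 = a6" "vec8 a0 a1 a2 a3 a4 a5 a6 a7 $ 7 = a7"
  by (simp_all add: vec8_def)

lemma vec8_eq_iff:
  "v = w \<longleftrightarrow> v $ 0 = w $ 0 \<and> v $ 1 = w $ 1 \<and> v $ 2 = w $ 2 \<and> v $ 3 = w $ 3 \<and>
    v $ 4 = w $ 4 \<and> v $ 5 = w $ 5 \<and> v $ 6 = w $ 6 \<and> v $ (7::8) = w $ 7"
proof
  assume "v $ 0 = w $ 0 \<and> v $ 1 = w $ 1 \<and> v $ 2 = w $ 2 \<and> v $ 3 = w $ 3 \<and>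
    v $ 4 = w $ 4 \<and> v $ 5 = w $ 5 \<and> v $ 6 = w $ 6 \<and> v $ (7::8) = w $ 7"
  then have "\<forall>i\<in>{0, 1, 2, 3, 4, 5, 6, 7 :: 8}. v $ i = w $ i"
    by auto
  then show "v = w"
    unfolding vec_eq_iff UNIV_8[symmetric] by blast
qed simp

lemma mem_proj_point: "w \<in> proj_point v \<longleftrightarrow> (\<exists>k. w = k *s v)"
  unfolding proj_point_def vec.span_singleton by auto

text \<open>Two orthogonal singular points span a totally singular line, and a generator through it
  would meet the ovoid twice. The expression is the polar form of \<open>Q7\<close>.\<close>

lemma ovoid_not_perp:
  fixes v w :: "'k::{field,finite} ^ 8"
  assumes ovoid: "is_ovoid Q7 S" and S: "proj_point v \<in> S" "proj_point w \<in> S"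
    and ne: "proj_point v \<noteq> proj_point w" and sing: "Q7 v = 0" "Q7 w = 0"
  shows "v $ 0 * w $ 7 + v $ 7 * w $ 0 + v $ 1 * w $ 6 + v $ 6 * w $ 1 + v $ 2 * w $ 5 +
    v $ 5 * w $ 2 + v $ 3 * w $ 4 + v $ 4 * w $ 3 \<noteq> 0" (is "?B \<noteq> 0")
proof
  assume perp: "?B = 0"
  define W0 where "W0 = vec.span {v, w}"
  have ts: "totally_singular Q7 W0"
    unfolding totally_singular_def
  proof (intro conjI ballI)
    show "vec.subspace W0"
      by (simp add: W0_def)
    fix u
    assume "u \<in> W0"
    then obtain j k where "u - j *s v = k *s w"
      unfolding W0_def vec.span_insert vec.span_singleton by auto
    then have u: "u = j *s v + k *s w"
      by (metis diff_add_cancel add.commute)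
    have "Q7 u = j\<^sup>2 * Q7 v + k\<^sup>2 * Q7 w + j * k * ?B"
      unfolding u Q7_def vector_add_component vector_smult_component by (simp only: semiring_normal)
    then show "Q7 u = 0"
      using perp sing by simp
  qed
  \<comment> \<open>The space is finite, so some totally singular subspace containing
    \<open>W0\<close> is maximal.\<close>
  define \<T> where "\<T> = {W. totally_singular Q7 W \<and> W0 \<subseteq> W}"
  have "finite \<T>" "W0 \<in> \<T>"
    using ts by (simp_all add: \<T>_def)
  then obtain W where W: "W \<in> \<T>" "\<And>W'. W' \<in> \<T> \<Longrightarrow> W \<subseteq> W' \<Longrightarrow> W' = W"
    using finite_has_maximal[of \<T>] by (metis empty_iff)
  then have "is_generator Q7 W"
    unfolding is_generator_def \<T>_def by auto
  then have "\<exists>!P. P \<in> S \<and> P \<subseteq> W"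
    using ovoid unfolding is_ovoid_def by blast
  moreover have "proj_point v \<subseteq> W" "proj_point w \<subseteq> W"
    using W(1) vec.span_mono[of "{v}" "{v, w}"] vec.span_mono[of "{w}" "{v, w}"]
    unfolding \<T>_def W0_def proj_point_def by auto
  ultimately show False
    using S ne by blast
qed

text \<open>Up to sign this is the polar form of the two points: their last coordinates turn it into
  a product of differences.\<close>

lemma O7_difference_nonzero:
  fixes f1 f2 f3 :: "'k::{field,finite} poly3"
  assumes ovoid: "is_ovoid Q7 (O7 f1 f2 f3)" and ne: "(x, y, z) \<noteq> (x', y', z')"
  shows "(x - x') * (eval3 f3 x y z - eval3 f3 x' y' z') + (y - y') * (eval3 f2 x y z - eval3 f2 x' y' z') +
    (z - z') * (eval3 f1 x y z - eval3 f1 x' y' z') \<noteq> 0"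
proof -
  define p where "p x y z = vec8 1 x y z (eval3 f1 x y z) (eval3 f2 x y z) (eval3 f3 x y z)
        (- z * eval3 f1 x y z - y * eval3 f2 x y z - x * eval3 f3 x y z)" for x y z
  have mem: "proj_point (p x y z) \<in> O7 f1 f2 f3" for x y z
    unfolding O7_def p_def by blast
  have sing: "Q7 (p x y z) = 0" for x y z
    by (simp add: Q7_def p_def)
  have "proj_point (p x y z) \<noteq> proj_point (p x' y' z')"
  proof
    assume "proj_point (p x y z) = proj_point (p x' y' z')"
    then have "p x y z \<in> proj_point (p x' y' z')"
      by (metis mem_proj_point vec.scale_one)
    then obtain k where k: "p x y z = k *s p x' y' z'"
      by (auto simp: mem_proj_point)
    have "k = 1"
      using arg_cong[OF k, of "\<lambda>v. v $ 0"] by (simp add: p_def)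
    then have "p x y z = p x' y' z'"
      using k by simp
    then show False
      using ne unfolding vec8_eq_iff by (simp add: p_def)
  qed
  from ovoid_not_perp[OF ovoid mem mem this sing sing] show ?thesis
    by (simp add: p_def algebra_simps)
qed

section \<open>Ternary quadratic and cubic forms\<close>

lemma ternary_quadratic_zero:
  fixes A B C D E G :: "'k::comm_ring_1"
  assumes "\<And>r s t. A * r\<^sup>2 + B * s\<^sup>2 + C * t\<^sup>2 + D * s * t + E * r * t + G * r * s = 0"
  shows "A = 0" and "B = 0" and "C = 0" and "D = 0" and "E = 0" and "G = 0"
proof -
  show *: "A = 0" "B = 0" "C = 0"
    using assms[of 1 0 0] assms[of 0 1 0] assms[of 0 0 1] by simp_all
  show "D = 0" "E = 0" "G = 0"
    using assms[of 0 1 1] assms[of 1 0 1] assms[of 1 1 0] * by simp_all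
qed

text \<open>A case of Chevalley's theorem, made explicit by square roots and the radical of the
  polar form.\<close>

lemma ternary_quadratic_isotropic_char2:
  fixes A B C D E G :: "'k::{field,finite}"
  assumes two: "(2::'k) = 0"
  obtains r s t where "A * r\<^sup>2 + B * s\<^sup>2 + C * t\<^sup>2 + D * s * t + E * r * t + G * r * s = 0"
    and "\<not> (r = 0 \<and> s = 0 \<and> t = 0)"
proof -
  note c2 = char2_simps[OF two]
  define q where "q r s t = A * r\<^sup>2 + B * s\<^sup>2 + C * t\<^sup>2 + D * s * t + E * r * t + G * r * s" for r s t
  have "\<exists>r s t. q r s t = 0 \<and> \<not> (r = 0 \<and> s = 0 \<and> t = 0)"
  proof (cases "G = 0")
    case True
    \<comment> \<open>At \<open>(b, a, 0)\<close> the form is \<open>A * B + B * A = 0\<close>; if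
      \<open>a = 0\<close>, then \<open>A = 0\<close> and \<open>(1, 0, 0)\<close> serves
      instead.\<close>
    obtain a b where ab: "a\<^sup>2 = A" "b\<^sup>2 = B"
      using finite_field_sqrt[OF two] by metis
    have "q b a 0 = A * B + B * A"
      by (simp add: q_def True ab)
    then have "q b a 0 = 0"
      by (simp add: mult.commute c2)
    moreover have "q 1 0 0 = 0" if "a = 0"
      using ab that by (simp add: q_def)
    ultimately show ?thesis
      by (cases "a = 0") (metis zero_neq_one)+
  next
    case False
    \<comment> \<open>\<open>(D, E, G)\<close> spans the radical of the polar form.\<close>
    show ?thesis
    proof (cases "q D E G = 0")
      case True
      then show ?thesis
        using False by blast
    next
      case nz: False
      \<comment> \<open>At \<open>(1, 0, 0)\<close> plus \<open>k\<close> times a radical vector the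
        form is \<open>k\<^sup>2 * q D E G + A\<close>, which this \<open>k\<close> makes
        zero.\<close>
      obtain k where k: "k\<^sup>2 = A / q D E G"
        using finite_field_sqrt[OF two] by metis
      have "q (k * D + 1) (k * E) (k * G) = k\<^sup>2 * q D E G + A"
        unfolding q_def by (simp only: semiring_normal mult_1_left mult_1_right c2)
      then have "q (k * D + 1) (k * E) (k * G) = 0"
        unfolding k using nz by (simp add: c2)
      moreover have "\<not> (k * D + 1 = 0 \<and> k * E = 0 \<and> k * G = 0)"
        using False by auto
      ultimately show ?thesis
        by blast
    qed
  qed
  then show ?thesis
    using that unfolding q_def by blast
qed

text \<open>
  Rescaling \<open>w\<close> shows that for each \<open>w \<noteq> 0\<close> exactly one of \<open>C w\<close> and \<open>D w\<close> vanishes; on the line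
  joining a zero of \<open>D\<close> with a non-zero this is too much for polynomials of degree three and one.
\<close>

lemma cubic_plus_quadratic_anisotropic:
  fixes C D :: "'k::{field,finite} \<Rightarrow> 'k \<Rightarrow> 'k \<Rightarrow> 'k"
  assumes two: "(2::'k) = 0" and card: "CARD('k) \<ge> 16"
    and C_def: "\<And>x y z. C x y z = x * (a3 * x\<^sup>2 + b3 * y\<^sup>2 + c3 * z\<^sup>2 + e * y * z) +
      y * (a2 * x\<^sup>2 + b2 * y\<^sup>2 + c2 * z\<^sup>2 + e * x * z) +
      z * (a1 * x\<^sup>2 + b1 * y\<^sup>2 + c1 * z\<^sup>2 + e * x * y)"
    and D_def: "\<And>x y z. D x y z = A * x\<^sup>2 + B * y\<^sup>2 + F * z\<^sup>2 + G * y * z + H * x * z + I * x * y"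
    and aniso: "\<And>x y z. C x y z + D x y z = 0 \<Longrightarrow> x = 0 \<and> y = 0 \<and> z = 0"
  shows "D x y z = 0" and "C x y z = 0 \<Longrightarrow> x = 0 \<and> y = 0 \<and> z = 0"
proof -
  note c2s = char2_simps[OF two]
  have one: "C x y z = 0 \<or> D x y z = 0" for x y z
  proof (rule ccontr)
    assume *: "\<not> (C x y z = 0 \<or> D x y z = 0)"
    \<comment> \<open>Scaling the vector by \<open>k\<close> turns \<open>C + D\<close> into
      \<open>k\<^sup>2 * (k * C + D)\<close>, and the two terms in the bracket are equal.\<close>
    define k where "k = D x y z / C x y z"
    have "k \<noteq> 0" "k * C x y z = D x y z"
      using * by (simp_all add: k_def)
    have "C (k * x) (k * y) (k * z) = k\<^sup>2 * (k * C x y z)" "D (k * x) (k * y) (k * z) = k\<^sup>2 * D x y z"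
      unfolding C_def D_def by (simp_all only: semiring_normal)
    then have "C (k * x) (k * y) (k * z) + D (k * x) (k * y) (k * z) = 0"
      unfolding \<open>k * C x y z = D x y z\<close> by (simp add: c2s)
    then have "x = 0 \<and> y = 0 \<and> z = 0"
      using aniso[of "k * x" "k * y" "k * z"] \<open>k \<noteq> 0\<close> by simp
    then show False
      using * by (simp add: C_def)
  qed
  obtain x1 y1 z1 where w1: "D x1 y1 z1 = 0" "\<not> (x1 = 0 \<and> y1 = 0 \<and> z1 = 0)"
    unfolding D_def using ternary_quadratic_isotropic_char2[OF two] by metis
  have C1: "C x1 y1 z1 \<noteq> 0"
    using aniso[of x1 y1 z1] w1 by auto
  show D0: "D x y z = 0" for x y z
  proof (rule ccontr)
    assume D: "D x y z \<noteq> 0"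
    define U where "U = x1 * (a3 * x\<^sup>2 + b3 * y\<^sup>2 + c3 * z\<^sup>2 + e * y * z) +
      y1 * (a2 * x\<^sup>2 + b2 * y\<^sup>2 + c2 * z\<^sup>2 + e * x * z) +
      z1 * (a1 * x\<^sup>2 + b1 * y\<^sup>2 + c1 * z\<^sup>2 + e * x * y)"
    define V where "V = x * (a3 * x1\<^sup>2 + b3 * y1\<^sup>2 + c3 * z1\<^sup>2 + e * y1 * z1) +
      y * (a2 * x1\<^sup>2 + b2 * y1\<^sup>2 + c2 * z1\<^sup>2 + e * x1 * z1) +
      z * (a1 * x1\<^sup>2 + b1 * y1\<^sup>2 + c1 * z1\<^sup>2 + e * x1 * y1)"
    define Z where "Z = G * (y * z1 + y1 * z) + H * (x * z1 + x1 * z) + I * (x * y1 + x1 * y)"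
    \<comment> \<open>The product of \<open>C\<close> and \<open>D\<close> along the line in
      direction \<open>(x1, y1, z1)\<close>; the factor for \<open>D\<close> is linear because
      \<open>D x1 y1 z1 = 0\<close>. So \<open>p\<close> has degree at most four and
      \<open>q\<close> roots.\<close>
    define p where "p = [:C x y z, U, V, C x1 y1 z1:] * [:D x y z, Z:]"
    have "p \<noteq> 0"
      unfolding p_def mult_eq_0_iff pCons_eq_0_iff using C1 D by simp
    have "poly p s = 0" for s
    proof -
      have "C (x + s * x1) (y + s * y1) (z + s * z1) = C x y z + s * U + s\<^sup>2 * V + s ^ 3 * C x1 y1 z1"
        unfolding C_def U_def V_def by (simp only: semiring_normal c2s)
      then have C: "poly [:C x y z, U, V, C x1 y1 z1:] s = C (x + s * x1) (y + s * y1) (z + s * z1)"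
        by (simp add: algebra_simps power2_eq_square power3_eq_cube)
      have "D (x + s * x1) (y + s * y1) (z + s * z1) = D x y z + s * Z + s\<^sup>2 * D x1 y1 z1"
        unfolding D_def Z_def by (simp only: semiring_normal c2s)
      then have "poly [:D x y z, Z:] s = D (x + s * x1) (y + s * y1) (z + s * z1)"
        by (simp add: w1)
      then show ?thesis
        unfolding p_def poly_mult C using one by auto
    qed
    then have "CARD('k) \<le> degree p"
      using card_poly_roots_bound[OF \<open>p \<noteq> 0\<close>] by simp
    moreover have "degree p \<le> degree [:C x y z, U, V, C x1 y1 z1:] + degree [:D x y z, Z:]"
      unfolding p_def by (rule degree_mult_le)
    moreover have "degree [:C x y z, U, V, C x1 y1 z1:] \<le> 3" "degree [:D x y z, Z:] \<le> 1"
      by simp_all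
    ultimately show False
      using card by linarith
  qed
  show "x = 0 \<and> y = 0 \<and> z = 0" if "C x y z = 0"
    using aniso[of x y z] that D0 by simp
qed

lemma quadratic_difference:
  fixes x y z r s t :: "'a::comm_ring_1"
  shows "(a * (x + r)\<^sup>2 + b * (y + s)\<^sup>2 + c * (z + t)\<^sup>2 + d * (y + s) * (z + t) + e * (x + r) * (z + t) +
      g * (x + r) * (y + s) + l * (x + r) + m * (y + s) + n * (z + t)) -
    (a * x\<^sup>2 + b * y\<^sup>2 + c * z\<^sup>2 + d * y * z + e * x * z + g * x * y + l * x + m * y + n * z) =
    (a * r\<^sup>2 + b * s\<^sup>2 + c * t\<^sup>2 + d * s * t + e * r * t + g * r * s) + (l * r + m * s + n * t) +
    x * (2 * a * r + g * s + e * t) + y * (g * r + 2 * b * s + d * t) + z * (e * r + d * s + 2 * c * t)"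
  by (simp add: algebra_simps power2_eq_square)

text \<open>
  The ovoid condition for the points belonging to \<open>u\<close> and \<open>u + w\<close> is affine linear in \<open>u\<close>, so its
  linear part must vanish for every \<open>w\<close>.
\<close>

lemma O7_normal_form:
  fixes f1 f2 f3 :: "'k::{field,finite} poly3"
  assumes card: "CARD('k) \<ge> 16"
    and deg: "total_degree3 f1 = 2" "total_degree3 f2 = 2" "total_degree3 f3 = 2"
    and zero: "eval3 f1 0 0 0 = 0" "eval3 f2 0 0 0 = 0" "eval3 f3 0 0 0 = 0"
    and ovoid: "is_ovoid Q7 (O7 f1 f2 f3)"
  obtains a1 b1 c1 a2 b2 c2 a3 b3 c3 e l m n where "(2::'k) = 0"
    and "\<And>x y z. eval3 f1 x y z = a1 * x\<^sup>2 + b1 * y\<^sup>2 + c1 * z\<^sup>2 + e * x * y + (l * x + m * y)"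
    and "\<And>x y z. eval3 f2 x y z = a2 * x\<^sup>2 + b2 * y\<^sup>2 + c2 * z\<^sup>2 + e * x * z + (n * x + m * z)"
    and "\<And>x y z. eval3 f3 x y z = a3 * x\<^sup>2 + b3 * y\<^sup>2 + c3 * z\<^sup>2 + e * y * z + (n * y + l * z)"
    and "\<And>x y z. x * (a3 * x\<^sup>2 + b3 * y\<^sup>2 + c3 * z\<^sup>2 + e * y * z) +
      y * (a2 * x\<^sup>2 + b2 * y\<^sup>2 + c2 * z\<^sup>2 + e * x * z) +
      z * (a1 * x\<^sup>2 + b1 * y\<^sup>2 + c1 * z\<^sup>2 + e * x * y) = 0 \<Longrightarrow> x = 0 \<and> y = 0 \<and> z = 0"
proof -
  obtain a1 b1 c1 d1 e1 g1 l1 m1 n1 where f1: "\<And>x y z. eval3 f1 x y z =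
      a1 * x\<^sup>2 + b1 * y\<^sup>2 + c1 * z\<^sup>2 + d1 * y * z + e1 * x * z + g1 * x * y + l1 * x + m1 * y + n1 * z"
    and nz: "\<not> (a1 = 0 \<and> b1 = 0 \<and> c1 = 0 \<and> d1 = 0 \<and> e1 = 0 \<and> g1 = 0)"
    using eval3_quadratic[OF deg(1) zero(1)] by metis
  obtain a2 b2 c2 d2 e2 g2 l2 m2 n2 where f2: "\<And>x y z. eval3 f2 x y z =
      a2 * x\<^sup>2 + b2 * y\<^sup>2 + c2 * z\<^sup>2 + d2 * y * z + e2 * x * z + g2 * x * y + l2 * x + m2 * y + n2 * z"
    using eval3_quadratic[OF deg(2) zero(2)] by metis
  obtain a3 b3 c3 d3 e3 g3 l3 m3 n3 where f3: "\<And>x y z. eval3 f3 x y z =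
      a3 * x\<^sup>2 + b3 * y\<^sup>2 + c3 * z\<^sup>2 + d3 * y * z + e3 * x * z + g3 * x * y + l3 * x + m3 * y + n3 * z"
    using eval3_quadratic[OF deg(3) zero(3)] by metis
  \<comment> \<open>\<open>C\<close> and \<open>D\<close> collect what the quadratic and the linear
    parts of the forms contribute independently of the base point; \<open>P1\<close>,
    \<open>P2\<close> and \<open>P3\<close> are the coefficients of its coordinates.\<close>
  define C where "C r s t =
    r * (a3 * r\<^sup>2 + b3 * s\<^sup>2 + c3 * t\<^sup>2 + d3 * s * t + e3 * r * t + g3 * r * s) +
    s * (a2 * r\<^sup>2 + b2 * s\<^sup>2 + c2 * t\<^sup>2 + d2 * s * t + e2 * r * t + g2 * r * s) +
    t * (a1 * r\<^sup>2 + b1 * s\<^sup>2 + c1 * t\<^sup>2 + d1 * s * t + e1 * r * t + g1 * r * s)" for r s t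
  define D where "D r s t = l3 * r\<^sup>2 + m2 * s\<^sup>2 + n1 * t\<^sup>2 + (n2 + m1) * s * t + (n3 + l1) * r * t +
    (m3 + l2) * r * s" for r s t
  define P1 where "P1 r s t = 2 * a3 * r\<^sup>2 + g2 * s\<^sup>2 + e1 * t\<^sup>2 + (e2 + g1) * s * t +
    (e3 + 2 * a1) * r * t + (g3 + 2 * a2) * r * s" for r s t
  define P2 where "P2 r s t = g3 * r\<^sup>2 + 2 * b2 * s\<^sup>2 + d1 * t\<^sup>2 + (d2 + 2 * b1) * s * t +
    (d3 + g1) * r * t + (2 * b3 + g2) * r * s" for r s t
  define P3 where "P3 r s t = e3 * r\<^sup>2 + d2 * s\<^sup>2 + 2 * c1 * t\<^sup>2 + (2 * c2 + d1) * s * t +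
    (2 * c3 + e1) * r * t + (d3 + e2) * r * s" for r s t
  have main: "C r s t + D r s t + x * P1 r s t + y * P2 r s t + z * P3 r s t \<noteq> 0"
    if "\<not> (r = 0 \<and> s = 0 \<and> t = 0)" for x y z r s t
  proof -
    have "(x + r, y + s, z + t) \<noteq> (x, y, z)"
      using that by auto
    from O7_difference_nonzero[OF ovoid this]
    have "r * (eval3 f3 (x + r) (y + s) (z + t) - eval3 f3 x y z) +
      s * (eval3 f2 (x + r) (y + s) (z + t) - eval3 f2 x y z) +
      t * (eval3 f1 (x + r) (y + s) (z + t) - eval3 f1 x y z) \<noteq> 0"
      by simp
    then show ?thesis
      unfolding f1 f2 f3 quadratic_difference C_def D_def P1_def P2_def P3_def
      by (simp only: semiring_normal not_False_eq_True)
  qed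
  have lin: "P = 0" if "\<And>u. c + u * P \<noteq> 0" for c P :: 'k
    using that[of "- c / P"] by (cases "P = 0") auto
  have P: "P1 r s t = 0" "P2 r s t = 0" "P3 r s t = 0" for r s t
  proof -
    show "P1 r s t = 0"
    proof (cases "r = 0 \<and> s = 0 \<and> t = 0")
      case False
      then show ?thesis
        using main[of r s t _ 0 0] by (intro lin[of "C r s t + D r s t"]) simp
    qed (simp add: P1_def)
    show "P2 r s t = 0"
    proof (cases "r = 0 \<and> s = 0 \<and> t = 0")
      case False
      then show ?thesis
        using main[of r s t 0 _ 0] by (intro lin[of "C r s t + D r s t"]) simp
    qed (simp add: P2_def)
    show "P3 r s t = 0"
    proof (cases "r = 0 \<and> s = 0 \<and> t = 0")
      case False
      then show ?thesis
        using main[of r s t 0 0] by (intro lin[of "C r s t + D r s t"]) simp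
    qed (simp add: P3_def)
  qed
  note q1 = ternary_quadratic_zero[OF P(1)[unfolded P1_def]]
  note q2 = ternary_quadratic_zero[OF P(2)[unfolded P2_def]]
  note q3 = ternary_quadratic_zero[OF P(3)[unfolded P3_def]]
  have two: "(2::'k) = 0"
  proof (rule ccontr)
    assume two: "(2::'k) \<noteq> 0"
    \<comment> \<open>Of the quadratic part of \<open>f1\<close> only \<open>g1\<close> remains, and
      the three sign relations give \<open>2 * g1 = 0\<close>, contrary to degree two.\<close>
    have z: "e1 = 0" "d1 = 0" "c1 = 0" "a1 = 0" "b1 = 0"
      using two q1 q2 q3 by auto
    have "e2 = - g1" "d3 = - g1" "d3 = - e2"
      using q1(4) q2(5) q3(6) by (simp_all add: eq_neg_iff_add_eq_0)
    then have "g1 + g1 = 0"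
      by (metis add.right_inverse minus_minus)
    then have "2 * g1 = 0"
      by simp
    then have "g1 = 0"
      using two by simp
    then show False
      using nz z by simp
  qed
  note c2s = char2_simps[OF two]
  have z: "g2 = 0" "e1 = 0" "g3 = 0" "d1 = 0" "e3 = 0" "d2 = 0" "e2 = g1" "d3 = g1"
    using q1 q2 q3 two by (auto simp: char2_add_eq_0_iff)
  have C: "C x y z = x * (a3 * x\<^sup>2 + b3 * y\<^sup>2 + c3 * z\<^sup>2 + g1 * y * z) +
      y * (a2 * x\<^sup>2 + b2 * y\<^sup>2 + c2 * z\<^sup>2 + g1 * x * z) +
      z * (a1 * x\<^sup>2 + b1 * y\<^sup>2 + c1 * z\<^sup>2 + g1 * x * y)" for x y z
    by (simp add: C_def z)
  have aniso: "x = 0 \<and> y = 0 \<and> z = 0" if "C x y z + D x y z = 0" for x y z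
    using main[of x y z 0 0 0] that by auto
  \<comment> \<open>The vanishing of \<open>D\<close> makes the matrix of the linear parts
    alternating.\<close>
  have "D x y z = 0" for x y z
    using two card C D_def aniso by (rule cubic_plus_quadratic_anisotropic(1))
  note d = ternary_quadratic_zero[OF this[unfolded D_def]]
  have C0: "x = 0 \<and> y = 0 \<and> z = 0" if "C x y z = 0" for x y z
    using two card C D_def aniso that by (rule cubic_plus_quadratic_anisotropic(2))
  have z': "l3 = 0" "m2 = 0" "n1 = 0" "n2 = m1" "n3 = l1" "m3 = l2"
    using d by (simp_all add: char2_add_eq_0_iff[OF two])
  show ?thesis
  proof (rule that[of a1 b1 c1 g1 l1 m1 a2 b2 c2 l2 a3 b3 c3])
    show "(2::'k) = 0"
      by (rule two)
    show "x = 0 \<and> y = 0 \<and> z = 0" if "x * (a3 * x\<^sup>2 + b3 * y\<^sup>2 + c3 * z\<^sup>2 + g1 * y * z) +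
      y * (a2 * x\<^sup>2 + b2 * y\<^sup>2 + c2 * z\<^sup>2 + g1 * x * z) +
      z * (a1 * x\<^sup>2 + b1 * y\<^sup>2 + c1 * z\<^sup>2 + g1 * x * y) = 0" for x y z
      using C0 that unfolding C by blast
  qed (simp_all add: f1 f2 f3 z z' add.assoc)
qed

subsection \<open>The isometry onto the Kantor ovoid\<close>

lemma power_card_square: "(x :: 'k::{field,finite} alg_closure) ^ (CARD('k) ^ 2) = (x ^ CARD('k)) ^ CARD('k)"
  by (simp add: power2_eq_square power_mult)

lemma mem_Fq3_iff: "(x :: 'k::{field,finite} alg_closure) \<in> Fq3 \<longleftrightarrow> ((x ^ CARD('k)) ^ CARD('k)) ^ CARD('k) = x"
  by (simp add: Fq3_def power3_eq_cube power_mult)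

lemma Fq3_mult: "x \<in> Fq3 \<Longrightarrow> y \<in> Fq3 \<Longrightarrow> x * y \<in> Fq3"
  by (simp add: Fq3_def power_mult_distrib)

lemma Fq3_inverse: "x \<in> Fq3 \<Longrightarrow> inverse x \<in> Fq3"
  by (simp add: Fq3_def power_inverse)

lemma Fq3_power: "x \<in> Fq3 \<Longrightarrow> x ^ n \<in> Fq3"
  by (simp add: Fq3_def power_power_commute[of x n])

lemma Fq3_add:
  fixes x y :: "'k::{field,finite} alg_closure"
  assumes "(2::'k) = 0" and "x \<in> Fq3" and "y \<in> Fq3"
  shows "x + y \<in> Fq3"
  using assms(2,3) by (simp add: mem_Fq3_iff frobenius_add[OF assms(1)])

lemma Tr3_add:
  fixes x y :: "'k::{field,finite} alg_closure"
  assumes "(2::'k) = 0"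
  shows "Tr3 (x + y) = Tr3 x + Tr3 y"
  by (simp add: Tr3_def power_card_square frobenius_add[OF assms] algebra_simps)

lemma Tr3_scale: "Tr3 (to_ac k * x) = to_ac k * Tr3 x"
  by (simp add: Tr3_def power_card_square power_mult_distrib frobenius_to_ac algebra_simps)

lemma Tr3_in_Fq:
  fixes x :: "'k::{field,finite} alg_closure"
  assumes "(2::'k) = 0" and "x \<in> Fq3"
  shows "Tr3 x \<in> Fq"
  unfolding mem_Fq_iff Tr3_def power_card_square frobenius_add[OF assms(1)]
  using assms(2) by (simp add: mem_Fq3_iff algebra_simps)

text \<open>The power \<open>t ^ (q + q\<^sup>2)\<close> is the product of the other two conjugates
  of \<open>t\<close>, so this trace is the derivative of the norm at \<open>t\<close> in direction
  \<open>r\<close>.\<close>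

lemma Tr3_norm_gradient:
  fixes r t :: "'k::{field,finite} alg_closure"
  assumes "t \<in> Fq3"
  shows "Tr3 (r * t ^ (CARD('k) + CARD('k) ^ 2)) = r * t ^ CARD('k) * (t ^ CARD('k)) ^ CARD('k) +
    r ^ CARD('k) * (t ^ CARD('k)) ^ CARD('k) * t + (r ^ CARD('k)) ^ CARD('k) * t * t ^ CARD('k)"
  using assms unfolding Tr3_def power_add power_card_square power_mult_distrib
  by (simp add: mem_Fq3_iff mult.assoc)

lemma N3_add:
  fixes r t :: "'k::{field,finite} alg_closure"
  assumes two: "(2::'k) = 0" and "t \<in> Fq3" and "r \<in> Fq3"
  shows "N3 (t + r) = N3 t + N3 r + Tr3 (r * t ^ (CARD('k) + CARD('k) ^ 2)) +
    Tr3 (t * r ^ (CARD('k) + CARD('k) ^ 2))"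
  unfolding Tr3_norm_gradient[OF assms(2)] Tr3_norm_gradient[OF assms(3)] N3_def power_card_square
    frobenius_add[OF two]
  by (simp only: semiring_normal)

lemma N3_scale: "N3 (to_ac k * x) = to_ac (k ^ 3) * N3 x"
  by (simp add: N3_def power_card_square power_mult_distrib frobenius_to_ac algebra_simps power3_eq_cube)

text \<open>Expanding \<open>C\<close> at \<open>u + k * v\<close> directly and through the norm,
  and comparing the parts linear and quadratic in \<open>k\<close>, identifies the two
  gradients.\<close>

lemma cubic_norm_gradient:
  fixes C :: "'k::{field,finite} \<Rightarrow> 'k \<Rightarrow> 'k \<Rightarrow> 'k"
  assumes two: "(2::'k) = 0" and card: "CARD('k) \<ge> 16"
    and C_def: "\<And>x y z. C x y z = x * (a3 * x\<^sup>2 + b3 * y\<^sup>2 + c3 * z\<^sup>2 + e * y * z) +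
      y * (a2 * x\<^sup>2 + b2 * y\<^sup>2 + c2 * z\<^sup>2 + e * x * z) +
      z * (a1 * x\<^sup>2 + b1 * y\<^sup>2 + c1 * z\<^sup>2 + e * x * y)"
    and \<Lambda>_def: "\<And>x y z. \<Lambda> x y z = to_ac x + \<alpha> * to_ac y + \<beta> * to_ac z"
    and \<Lambda>: "\<And>x y z. \<Lambda> x y z \<in> Fq3"
    and CN: "\<And>x y z. to_ac (C x y z) = to_ac a * N3 (\<Lambda> x y z)"
  shows "to_ac (r * (a3 * x\<^sup>2 + b3 * y\<^sup>2 + c3 * z\<^sup>2 + e * y * z) +
      s * (a2 * x\<^sup>2 + b2 * y\<^sup>2 + c2 * z\<^sup>2 + e * x * z) +
      t * (a1 * x\<^sup>2 + b1 * y\<^sup>2 + c1 * z\<^sup>2 + e * x * y)) =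
    to_ac a * Tr3 (\<Lambda> r s t * \<Lambda> x y z ^ (CARD('k) + CARD('k) ^ 2))"
proof -
  note c2s = char2_simps[OF two]
  note c2' = char2_simps[OF char2_to_ac[OF two]]
  define P where "P x y z r s t = r * (a3 * x\<^sup>2 + b3 * y\<^sup>2 + c3 * z\<^sup>2 + e * y * z) +
      s * (a2 * x\<^sup>2 + b2 * y\<^sup>2 + c2 * z\<^sup>2 + e * x * z) +
      t * (a1 * x\<^sup>2 + b1 * y\<^sup>2 + c1 * z\<^sup>2 + e * x * y)" for x y z r s t
  define T where "T u v = to_ac a * Tr3 (v * u ^ (CARD('k) + CARD('k) ^ 2))" for u v :: "'k alg_closure"
  let ?u = "\<Lambda> x y z" and ?v = "\<Lambda> r s t"
  have "to_ac k * (to_ac (P x y z r s t) + T ?u ?v) = to_ac (k\<^sup>2) * (to_ac (P r s t x y z) + T ?v ?u)" for k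
  proof -
    have "C (x + k * r) (y + k * s) (z + k * t) =
      C x y z + k ^ 3 * C r s t + k * P x y z r s t + k\<^sup>2 * P r s t x y z"
      unfolding C_def P_def by (simp only: semiring_normal c2s)
    then have C: "to_ac a * N3 (\<Lambda> (x + k * r) (y + k * s) (z + k * t)) =
      to_ac a * N3 ?u + to_ac (k ^ 3) * (to_ac a * N3 ?v) + to_ac k * to_ac (P x y z r s t) +
      to_ac (k\<^sup>2) * to_ac (P r s t x y z)"
      unfolding CN[symmetric] to_ac_mult[symmetric] to_ac_add[symmetric] by simp
    have kv: "to_ac k * ?v = \<Lambda> (k * r) (k * s) (k * t)"
      by (simp add: \<Lambda>_def algebra_simps)
    have "\<Lambda> (x + k * r) (y + k * s) (z + k * t) = ?u + to_ac k * ?v"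
      by (simp add: \<Lambda>_def algebra_simps)
    moreover have "to_ac a * N3 (?u + to_ac k * ?v) = to_ac a * N3 ?u + to_ac (k ^ 3) * (to_ac a * N3 ?v) +
      to_ac k * T ?u ?v + to_ac (k\<^sup>2) * T ?v ?u"
    proof -
      have "N3 (?u + to_ac k * ?v) = N3 ?u + N3 (to_ac k * ?v) +
        Tr3 (to_ac k * ?v * ?u ^ (CARD('k) + CARD('k) ^ 2)) +
        Tr3 (?u * (to_ac k * ?v) ^ (CARD('k) + CARD('k) ^ 2))"
        by (rule N3_add[OF two \<Lambda>]) (simp only: kv \<Lambda>)
      moreover have "Tr3 (to_ac k * ?v * ?u ^ (CARD('k) + CARD('k) ^ 2)) =
        to_ac k * Tr3 (?v * ?u ^ (CARD('k) + CARD('k) ^ 2))"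
        unfolding mult.assoc Tr3_scale ..
      moreover have "to_ac k ^ (CARD('k) + CARD('k) ^ 2) = to_ac (k\<^sup>2)"
        by (simp add: power_add power_card_square frobenius_to_ac) (simp add: power2_eq_square)
      then have "Tr3 (?u * (to_ac k * ?v) ^ (CARD('k) + CARD('k) ^ 2)) =
        to_ac (k\<^sup>2) * Tr3 (?u * ?v ^ (CARD('k) + CARD('k) ^ 2))"
        unfolding power_mult_distrib mult.left_commute[of ?u] by (simp only: Tr3_scale)
      ultimately show ?thesis
        by (simp only: T_def N3_scale) (simp only: distrib_left mult.left_commute)
    qed
    ultimately have "to_ac k * T ?u ?v + to_ac (k\<^sup>2) * T ?v ?u =
      to_ac k * to_ac (P x y z r s t) + to_ac (k\<^sup>2) * to_ac (P r s t x y z)"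
      using C by (simp only: add.assoc add_left_cancel)
    then have "to_ac k * to_ac (P x y z r s t) - to_ac k * T ?u ?v =
      to_ac (k\<^sup>2) * T ?v ?u - to_ac (k\<^sup>2) * to_ac (P r s t x y z)"
      by (simp only: algebra_simps)
    then show ?thesis
      unfolding c2' by (simp only: distrib_left add.commute)
  qed
  note * = this
  \<comment> \<open>Two values of \<open>k\<close> suffice: \<open>k = 1\<close> makes the linear
    and quadratic discrepancies equal, and a \<open>k\<close> with
    \<open>k \<noteq> k\<^sup>2\<close> then forces them to vanish.\<close>
  obtain k :: 'k where k: "k \<noteq> 0" "k \<noteq> 1"
  proof -
    have "\<not> UNIV \<subseteq> {0, 1::'k}"
      using card card_mono[of "{0, 1::'k}" UNIV] by auto
    then show ?thesis
      using that by blast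
  qed
  have "to_ac (P x y z r s t) + T ?u ?v = to_ac (P r s t x y z) + T ?v ?u"
    using *[of 1] by simp
  then have "(to_ac k - to_ac (k\<^sup>2)) * (to_ac (P x y z r s t) + T ?u ?v) = 0"
    using *[of k] by (simp add: left_diff_distrib)
  moreover have "to_ac k - to_ac (k\<^sup>2) \<noteq> 0"
    using k by (metis to_ac_diff to_ac_eq_0_iff eq_iff_diff_eq_0 power2_eq_square mult_cancel_right2)
  ultimately have "to_ac (P x y z r s t) = T ?u ?v"
    by (simp add: char2_add_eq_0_iff[OF char2_to_ac[OF two]])
  then show ?thesis
    unfolding P_def T_def .
qed

text \<open>Injectivity gives \<open>q ^ 3\<close> values in \<open>Fq3\<close>, which has at most
  that many elements.\<close>

lemma bij_betw_norm_coordinates: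
  fixes \<Lambda> :: "'k::{field,finite} \<Rightarrow> 'k \<Rightarrow> 'k \<Rightarrow> 'k alg_closure"
  assumes two: "(2::'k) = 0"
    and add: "\<And>x y z x' y' z'. \<Lambda> (x + x') (y + y') (z + z') = \<Lambda> x y z + \<Lambda> x' y' z'"
    and \<Lambda>: "\<And>x y z. \<Lambda> x y z \<in> Fq3"
    and inj: "\<And>x y z. \<Lambda> x y z = 0 \<Longrightarrow> x = 0 \<and> y = 0 \<and> z = 0"
  shows "bij_betw (\<lambda>(x, y, z). \<Lambda> x y z) UNIV Fq3" and "card (Fq3 :: 'k alg_closure set) = CARD('k) ^ 3"
proof -
  let ?L = "\<lambda>(x, y, z). \<Lambda> x y z"
  have "inj ?L"
  proof (rule injI)
    fix p p' :: "'k \<times> 'k \<times> 'k"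
    assume eq: "?L p = ?L p'"
    obtain x y z x' y' z' where p: "p = (x, y, z)" "p' = (x', y', z')"
      by (metis prod_cases3)
    have "\<Lambda> (x + x') (y + y') (z + z') = 0"
      using eq unfolding p add by (simp add: char2_simps[OF char2_to_ac[OF two]])
    then show "p = p'"
      using inj[of "x + x'" "y + y'" "z + z'"] unfolding p by (simp add: char2_add_eq_0_iff[OF two])
  qed
  then have card: "card (range ?L) = CARD('k) ^ 3"
    by (simp add: card_image card_prod power3_eq_cube)
  moreover have sub: "range ?L \<subseteq> Fq3"
    using \<Lambda> by auto
  ultimately have eq: "range ?L = Fq3"
    using card_Fq3_le by (intro card_seteq finite_Fq3) auto
  then show "bij_betw ?L UNIV Fq3"
    using \<open>inj ?L\<close> by (simp add: bij_betw_def)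
  show "card (Fq3 :: 'k alg_closure set) = CARD('k) ^ 3"
    using card eq by simp
qed

lemma proj_point_scale:
  fixes v :: "'k::field ^ 'n"
  assumes "k \<noteq> 0"
  shows "proj_point (k *s v) = proj_point v"
proof -
  have "j *s v = (j / k) *s (k *s v)" for j
    using assms by (simp add: vec.scale_scale)
  then show ?thesis
    unfolding set_eq_iff mem_proj_point by (metis vec.scale_scale)
qed

text \<open>
  The isometry is the one of the definition of the Kantor ovoid, for the basis \<open>1, \<alpha>, \<beta>\<close>,
  composed with the alternating map \<open>L\<close> that accounts for the linear terms of the \<open>f\<^sub>i\<close> and with
  the scaling by \<open>\<sigma> = a\<^sub>3 ^ (1 / 2)\<close> that accounts for the leading coefficient.
\<close>

lemma O7_is_kantor_ovoid:
  fixes f1 f2 f3 :: "'k::{field,finite} poly3"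
  assumes two: "(2::'k) = 0" and card: "CARD('k) \<ge> 16"
    and f1: "\<And>x y z. eval3 f1 x y z = a1 * x\<^sup>2 + b1 * y\<^sup>2 + c1 * z\<^sup>2 + e * x * y + (l * x + m * y)"
    and f2: "\<And>x y z. eval3 f2 x y z = a2 * x\<^sup>2 + b2 * y\<^sup>2 + c2 * z\<^sup>2 + e * x * z + (n * x + m * z)"
    and f3: "\<And>x y z. eval3 f3 x y z = a3 * x\<^sup>2 + b3 * y\<^sup>2 + c3 * z\<^sup>2 + e * y * z + (n * y + l * z)"
    and aniso: "\<And>x y z. x * (a3 * x\<^sup>2 + b3 * y\<^sup>2 + c3 * z\<^sup>2 + e * y * z) +
      y * (a2 * x\<^sup>2 + b2 * y\<^sup>2 + c2 * z\<^sup>2 + e * x * z) +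
      z * (a1 * x\<^sup>2 + b1 * y\<^sup>2 + c1 * z\<^sup>2 + e * x * y) = 0 \<Longrightarrow> x = 0 \<and> y = 0 \<and> z = 0"
  shows "is_kantor_ovoid (O7 f1 f2 f3)"
proof -
  note c2s = char2_simps[OF two]
  define C where "C x y z = x * (a3 * x\<^sup>2 + b3 * y\<^sup>2 + c3 * z\<^sup>2 + e * y * z) +
      y * (a2 * x\<^sup>2 + b2 * y\<^sup>2 + c2 * z\<^sup>2 + e * x * z) +
      z * (a1 * x\<^sup>2 + b1 * y\<^sup>2 + c1 * z\<^sup>2 + e * x * y)" for x y z
  note aniso = aniso[folded C_def]
  obtain \<alpha> \<beta> where ab: "\<And>x y z. to_ac x + \<alpha> * to_ac y + \<beta> * to_ac z \<in> Fq3"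
    "\<And>x y z. to_ac (C x y z) = to_ac a3 * N3 (to_ac x + \<alpha> * to_ac y + \<beta> * to_ac z)"
    using anisotropic_cubic_norm[OF two card C_def aniso] by metis
  define \<Lambda> where "\<Lambda> x y z = to_ac x + \<alpha> * to_ac y + \<beta> * to_ac z" for x y z
  note \<Lambda> = ab(1)[folded \<Lambda>_def] and CN = ab(2)[folded \<Lambda>_def]
  note grad = cubic_norm_gradient[OF two card C_def \<Lambda>_def \<Lambda> CN]
  have \<Lambda>_add: "\<Lambda> (x + x') (y + y') (z + z') = \<Lambda> x y z + \<Lambda> x' y' z'" for x y z x' y' z'
    by (simp add: \<Lambda>_def algebra_simps)
  have \<Lambda>_scale: "\<Lambda> (k * x) (k * y) (k * z) = to_ac k * \<Lambda> x y z" for k x y z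
    by (simp add: \<Lambda>_def algebra_simps)
  have \<Lambda>_0: "x = 0 \<and> y = 0 \<and> z = 0" if "\<Lambda> x y z = 0" for x y z
  proof -
    have "to_ac (C x y z) = 0"
      using that by (simp add: CN N3_def)
    then have "C x y z = 0"
      by (simp only: to_ac_eq_0_iff)
    then show ?thesis
      by (rule aniso)
  qed
  note bij = bij_betw_norm_coordinates[of \<Lambda>, OF two \<Lambda>_add \<Lambda> \<Lambda>_0]
  have "a3 \<noteq> 0"
    using aniso[of 1 0 0] by (auto simp: C_def)
  obtain \<sigma> where \<sigma>: "\<sigma>\<^sup>2 = a3"
    using finite_field_sqrt[OF two] .
  then have "\<sigma> \<noteq> 0"
    using \<open>a3 \<noteq> 0\<close> by auto
  \<comment> \<open>The first four coordinates are scaled by \<open>\<rho>\<close> and the last four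
    by \<open>\<sigma>\<close>: \<open>\<rho> * \<sigma> = 1\<close> preserves \<open>Q7\<close>,
    and the ratio \<open>\<sigma> / \<rho>\<close> is \<open>a3\<close>.\<close>
  define \<rho> where "\<rho> = 1 / \<sigma>"
  have \<rho>: "\<rho> \<noteq> 0" "\<rho> * \<sigma> = 1" "\<rho> * a3 = \<sigma>"
    using \<open>\<sigma> \<noteq> 0\<close> by (simp_all add: \<rho>_def \<sigma>[symmetric] power2_eq_square)
  define T where "T x = of_ac (Tr3 x)" for x :: "'k alg_closure"
  have T: "to_ac (T x) = Tr3 x" if "x \<in> Fq3" for x
    using Tr3_in_Fq[OF two that] unfolding T_def Fq_def by (rule to_ac_of_ac)
  have "\<Lambda> 0 1 0 \<in> Fq3" "\<Lambda> 0 0 1 \<in> Fq3"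
    by (rule \<Lambda>)+
  then have ab3: "\<alpha> \<in> Fq3" "\<beta> \<in> Fq3"
    by (simp_all add: \<Lambda>_def)
  have T_add: "T (x + y) = T x + T y" if "x \<in> Fq3" "y \<in> Fq3" for x y
    using T[of "x + y"] T[of x] T[of y] that Fq3_add[OF two] Tr3_add[OF two]
    by (metis to_ac_add to_ac_eq_iff)
  have Fq3_scale: "to_ac k * x \<in> Fq3" if "x \<in> Fq3" for k :: 'k and x
  proof -
    have "\<Lambda> k 0 0 \<in> Fq3"
      by (rule \<Lambda>)
    then show ?thesis
      using that by (simp add: \<Lambda>_def Fq3_mult)
  qed
  have T_scale: "T (to_ac k * x) = k * T x" if "x \<in> Fq3" for k x
    using T[of "to_ac k * x"] T[of x] that Fq3_scale Tr3_scale
    by (metis to_ac_mult to_ac_eq_iff)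
  define coord where "coord = inv_into UNIV (\<lambda>(x, y, z). \<Lambda> x y z)"
  have coord: "coord (\<Lambda> x y z) = (x, y, z)" for x y z
    using inv_into_f_f[OF bij_betw_imp_inj_on[OF bij(1)], of "(x, y, z)"] by (simp add: coord_def)
  define \<phi> :: "'k kantor_vec \<Rightarrow> 'k ^ 8" where
    "\<phi> = (\<lambda>(a, g, \<delta>, d). case coord g of (x, y, z) \<Rightarrow>
      vec8 (\<rho> * of_ac a) (\<rho> * x) (\<rho> * y) (\<rho> * z) (\<sigma> * T (\<beta> * \<delta>) + \<rho> * (l * x + m * y))
        (\<sigma> * T (\<alpha> * \<delta>) + \<rho> * (n * x + m * z)) (\<sigma> * T \<delta> + \<rho> * (n * y + l * z)) (\<sigma> * of_ac d))"
  have \<phi>: "\<phi> (to_ac a, \<Lambda> x y z, \<delta>, to_ac d) =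
      vec8 (\<rho> * a) (\<rho> * x) (\<rho> * y) (\<rho> * z) (\<sigma> * T (\<beta> * \<delta>) + \<rho> * (l * x + m * y))
        (\<sigma> * T (\<alpha> * \<delta>) + \<rho> * (n * x + m * z)) (\<sigma> * T \<delta> + \<rho> * (n * y + l * z)) (\<sigma> * d)" for a x y z \<delta> d
    by (simp add: \<phi>_def coord)
  have \<Lambda>_surj: "\<exists>x y z. g = \<Lambda> x y z" if "g \<in> Fq3" for g
    using that bij_betw_imp_surj_on[OF bij(1)] by (metis (mono_tags, lifting) imageE case_prod_conv prod_cases3)
  have space: thesis
    if "u \<in> kantor_space" "\<And>a x y z \<delta> d. u = (to_ac a, \<Lambda> x y z, \<delta>, to_ac d) \<Longrightarrow> \<delta> \<in> Fq3 \<Longrightarrow> thesis"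
    for u thesis
    using that \<Lambda>_surj unfolding kantor_space_def Fq_def by (auto elim!: SigmaE) metis
  have additive: "\<phi> (u + w) = \<phi> u + \<phi> w" if uw: "u \<in> kantor_space" "w \<in> kantor_space" for u w
  proof -
    obtain a x y z \<delta> d where u: "u = (to_ac a, \<Lambda> x y z, \<delta>, to_ac d)" "\<delta> \<in> Fq3"
      using space[OF uw(1)] by metis
    obtain a' x' y' z' \<delta>' d' where w: "w = (to_ac a', \<Lambda> x' y' z', \<delta>', to_ac d')" "\<delta>' \<in> Fq3"
      using space[OF uw(2)] by metis
    have sum: "u + w = (to_ac (a + a'), \<Lambda> (x + x') (y + y') (z + z'), \<delta> + \<delta>', to_ac (d + d'))"
      by (simp add: u w \<Lambda>_add)
    show ?thesis
      unfolding sum unfolding u(1) w(1) \<phi> vec8_eq_iff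
      using u(2) w(2) ab3 by (simp add: T_add Fq3_mult distrib_left add_ac)
  qed
  have scale: "\<phi> (kantor_scale k u) = k *s \<phi> u" if uw: "u \<in> kantor_space" for k u
  proof -
    obtain a x y z \<delta> d where u: "u = (to_ac a, \<Lambda> x y z, \<delta>, to_ac d)" "\<delta> \<in> Fq3"
      using space[OF uw] by metis
    have ku: "kantor_scale k u = (to_ac (k * a), \<Lambda> (k * x) (k * y) (k * z), to_ac k * \<delta>, to_ac (k * d))"
      by (simp add: u \<Lambda>_scale)
    have "T (\<beta> * (to_ac k * \<delta>)) = k * T (\<beta> * \<delta>)" "T (\<alpha> * (to_ac k * \<delta>)) = k * T (\<alpha> * \<delta>)"
      "T (to_ac k * \<delta>) = k * T \<delta>"
      using u ab3 by (simp_all add: mult.left_commute[of _ "to_ac k"] T_scale Fq3_mult)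
    then show ?thesis
      unfolding ku unfolding u(1) \<phi> vec8_eq_iff by (simp add: algebra_simps)
  qed
  have form: "to_ac (Q7 (\<phi> u)) = kantor_form u" if uw: "u \<in> kantor_space" for u
  proof -
    obtain a x y z \<delta> d where u: "u = (to_ac a, \<Lambda> x y z, \<delta>, to_ac d)" "\<delta> \<in> Fq3"
      using space[OF uw] by metis
    \<comment> \<open>The terms in \<open>l\<close>, \<open>m\<close> and \<open>n\<close> each
      occur twice and cancel.\<close>
    have "Q7 (\<phi> u) = (\<rho> * \<sigma>) * (a * d + x * T \<delta> + y * T (\<alpha> * \<delta>) + z * T (\<beta> * \<delta>))"
      unfolding u \<phi> Q7_def vec8_nth by (simp only: semiring_normal c2s)
    then have "Q7 (\<phi> u) = a * d + x * T \<delta> + y * T (\<alpha> * \<delta>) + z * T (\<beta> * \<delta>)"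
      by (simp add: \<rho>)
    moreover have "\<Lambda> x y z * \<delta> = to_ac x * \<delta> + to_ac y * (\<alpha> * \<delta>) + to_ac z * (\<beta> * \<delta>)"
      by (simp add: \<Lambda>_def algebra_simps)
    ultimately show ?thesis
      using u ab3 by (simp add: T Fq3_mult Tr3_add[OF two] Tr3_scale)
  qed
  have "inj_on \<phi> kantor_space"
  proof (rule inj_onI)
    fix u w
    assume uw: "u \<in> kantor_space" "w \<in> kantor_space" "\<phi> u = \<phi> w"
    obtain a x y z \<delta> d where u: "u = (to_ac a, \<Lambda> x y z, \<delta>, to_ac d)" "\<delta> \<in> Fq3"
      using space[OF uw(1)] by metis
    obtain a' x' y' z' \<delta>' d' where w: "w = (to_ac a', \<Lambda> x' y' z', \<delta>', to_ac d')" "\<delta>' \<in> Fq3"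
      using space[OF uw(2)] by metis
    have eq: "a = a'" "x = x'" "y = y'" "z = z'" "d = d'"
      "T \<delta> = T \<delta>'" "T (\<alpha> * \<delta>) = T (\<alpha> * \<delta>')" "T (\<beta> * \<delta>) = T (\<beta> * \<delta>')"
      using uw(3) \<rho>(1) \<open>\<sigma> \<noteq> 0\<close> unfolding u w \<phi> vec8_eq_iff by auto
    define \<epsilon> where "\<epsilon> = \<delta> + \<delta>'"
    have "\<epsilon> \<in> Fq3"
      using u w Fq3_add[OF two] by (simp add: \<epsilon>_def)
    have tr: "Tr3 \<epsilon> = 0" "Tr3 (\<alpha> * \<epsilon>) = 0" "Tr3 (\<beta> * \<epsilon>) = 0"
      unfolding \<epsilon>_def distrib_left Tr3_add[OF two] using eq u w ab3
      by (simp_all add: T[symmetric] Fq3_mult char2_simps[OF char2_to_ac[OF two]])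
    \<comment> \<open>Nondegeneracy of the trace form: \<open>inverse \<epsilon>\<close> is a
      combination of \<open>1\<close>, \<open>\<alpha>\<close>, \<open>\<beta>\<close>, so
      \<open>Tr3 1\<close> would be 0, but it is 3 = 1.\<close>
    have "\<epsilon> = 0"
    proof (rule ccontr)
      assume "\<epsilon> \<noteq> 0"
      obtain x y z where xyz: "inverse \<epsilon> = \<Lambda> x y z"
        using \<Lambda>_surj[OF Fq3_inverse[OF \<open>\<epsilon> \<in> Fq3\<close>]] by blast
      have "inverse \<epsilon> * \<epsilon> = to_ac x * \<epsilon> + to_ac y * (\<alpha> * \<epsilon>) + to_ac z * (\<beta> * \<epsilon>)"
        unfolding xyz by (simp add: \<Lambda>_def algebra_simps)
      then have "Tr3 (inverse \<epsilon> * \<epsilon>) = 0"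
        by (simp only: Tr3_add[OF two] Tr3_scale tr) simp
      moreover have "Tr3 (1 :: 'k alg_closure) = 1"
        by (simp add: Tr3_def char2_simps[OF char2_to_ac[OF two]] add.assoc)
      ultimately show False
        using \<open>\<epsilon> \<noteq> 0\<close> by simp
    qed
    then show "u = w"
      unfolding u w eq \<epsilon>_def by (simp add: char2_add_eq_0_iff[OF char2_to_ac[OF two]])
  qed
  \<comment> \<open>Both spaces have \<open>q ^ 8\<close> elements, so injectivity gives
    bijectivity.\<close>
  moreover have "card (kantor_space :: 'k kantor_vec set) = CARD('k ^ 8)"
  proof -
    have "card (Fq :: 'k alg_closure set) = CARD('k)"
      unfolding Fq_def by (simp add: card_image inj_to_ac)
    then have "card (kantor_space :: 'k kantor_vec set) = CARD('k) * (CARD('k) ^ 3 * (CARD('k) ^ 3 * CARD('k)))"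
      unfolding kantor_space_def by (simp add: card_cartesian_product bij(2))
    also have "\<dots> = CARD('k) ^ 8"
      by (simp add: numeral_eq_Suc)
    finally show ?thesis
      by (simp add: CARD_vec)
  qed
  ultimately have "\<phi> ` kantor_space = UNIV"
    by (intro card_subset_eq) (simp_all add: card_image)
  with \<open>inj_on \<phi> kantor_space\<close> have "bij_betw \<phi> kantor_space UNIV"
    by (simp add: bij_betw_def)
  then have iso: "kantor_isometry \<phi>"
    unfolding kantor_isometry_def using additive scale form by blast
  define p where "p x y z = vec8 1 x y z (eval3 f1 x y z) (eval3 f2 x y z) (eval3 f3 x y z)
        (- z * eval3 f1 x y z - y * eval3 f2 x y z - x * eval3 f3 x y z)" for x y z
  have infinity: "proj_point (\<phi> (0, 0, 0, 1)) = proj_point (vec8 0 0 0 0 0 0 0 1)"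
  proof -
    have "\<Lambda> 0 0 0 = 0"
      by (simp add: \<Lambda>_def)
    moreover have "T 0 = 0"
      by (simp add: T_def Tr3_def power_0_left)
    ultimately have "\<phi> (0, 0, 0, 1) = \<sigma> *s vec8 0 0 0 0 0 0 0 1"
      using \<phi>[of 0 0 0 0 0 1] by (simp add: vec8_eq_iff)
    then show ?thesis
      using \<open>\<sigma> \<noteq> 0\<close> by (simp add: proj_point_scale)
  qed
  have affine: "proj_point (\<phi> (1, \<Lambda> x y z, \<Lambda> x y z ^ (CARD('k) + CARD('k) ^ 2), N3 (\<Lambda> x y z))) = proj_point (p x y z)"
    for x y z
  proof -
    let ?\<delta> = "\<Lambda> x y z ^ (CARD('k) + CARD('k) ^ 2)"
    have "?\<delta> \<in> Fq3"
      using \<Lambda> by (rule Fq3_power)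
    \<comment> \<open>The gradient identity in the three coordinate directions, where
      \<open>\<Lambda>\<close> takes the values \<open>1\<close>, \<open>\<alpha>\<close>,
      \<open>\<beta>\<close>.\<close>
    have grads: "a3 * T ?\<delta> = a3 * x\<^sup>2 + b3 * y\<^sup>2 + c3 * z\<^sup>2 + e * y * z"
      "a3 * T (\<alpha> * ?\<delta>) = a2 * x\<^sup>2 + b2 * y\<^sup>2 + c2 * z\<^sup>2 + e * x * z"
      "a3 * T (\<beta> * ?\<delta>) = a1 * x\<^sup>2 + b1 * y\<^sup>2 + c1 * z\<^sup>2 + e * x * y"
    proof -
      have "\<Lambda> 1 0 0 = 1" "\<Lambda> 0 1 0 = \<alpha>" "\<Lambda> 0 0 1 = \<beta>"
        by (simp_all add: \<Lambda>_def)
      note grad' = grad[of 1 x y z 0 0, unfolded this] grad[of 0 x y z 1 0, unfolded this] grad[of 0 x y z 0 1, unfolded this]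
      have "to_ac (a3 * T ?\<delta>) = to_ac (a3 * x\<^sup>2 + b3 * y\<^sup>2 + c3 * z\<^sup>2 + e * y * z)"
        using grad'(1) by (simp add: T[OF \<open>?\<delta> \<in> Fq3\<close>])
      then show "a3 * T ?\<delta> = a3 * x\<^sup>2 + b3 * y\<^sup>2 + c3 * z\<^sup>2 + e * y * z"
        by (simp only: to_ac_eq_iff)
      have "to_ac (a3 * T (\<alpha> * ?\<delta>)) = to_ac (a2 * x\<^sup>2 + b2 * y\<^sup>2 + c2 * z\<^sup>2 + e * x * z)"
        using grad'(2) by (simp add: T[OF Fq3_mult[OF ab3(1) \<open>?\<delta> \<in> Fq3\<close>]])
      then show "a3 * T (\<alpha> * ?\<delta>) = a2 * x\<^sup>2 + b2 * y\<^sup>2 + c2 * z\<^sup>2 + e * x * z"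
        by (simp only: to_ac_eq_iff)
      have "to_ac (a3 * T (\<beta> * ?\<delta>)) = to_ac (a1 * x\<^sup>2 + b1 * y\<^sup>2 + c1 * z\<^sup>2 + e * x * y)"
        using grad'(3) by (simp add: T[OF Fq3_mult[OF ab3(2) \<open>?\<delta> \<in> Fq3\<close>]])
      then show "a3 * T (\<beta> * ?\<delta>) = a1 * x\<^sup>2 + b1 * y\<^sup>2 + c1 * z\<^sup>2 + e * x * y"
        by (simp only: to_ac_eq_iff)
    qed
    have N: "N3 (\<Lambda> x y z) = to_ac (C x y z / a3)"
      using CN[of x y z] \<open>a3 \<noteq> 0\<close> by simp
    \<comment> \<open>The alternating linear terms cancel, so the last coordinate is the cubic form
      itself.\<close>
    have last: "- z * eval3 f1 x y z - y * eval3 f2 x y z - x * eval3 f3 x y z = C x y z"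
      unfolding f1 f2 f3 C_def c2s by (simp only: semiring_normal c2s)
    have \<sigma>': "\<sigma> * w = \<rho> * (a3 * w)" for w
      using \<rho>(3) by (simp add: mult.assoc[symmetric])
    have "\<phi> (1, \<Lambda> x y z, ?\<delta>, N3 (\<Lambda> x y z)) = \<rho> *s p x y z"
      unfolding N p_def last unfolding f1 f2 f3 using \<phi>[of 1 x y z ?\<delta> "C x y z / a3"] \<open>a3 \<noteq> 0\<close>
      by (simp add: vec8_eq_iff \<sigma>' grads distrib_left)
    then show ?thesis
      using \<rho>(1) by (simp add: proj_point_scale)
  qed
  have "O7 f1 f2 f3 = (\<lambda>u. proj_point (\<phi> u)) ` kantor_vectors"
  proof
    show "O7 f1 f2 f3 \<subseteq> (\<lambda>u. proj_point (\<phi> u)) ` kantor_vectors"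
    proof
      fix P
      assume "P \<in> O7 f1 f2 f3"
      then consider "P = proj_point (vec8 0 0 0 0 0 0 0 1)" | x y z where "P = proj_point (p x y z)"
        unfolding O7_def p_def by blast
      then show "P \<in> (\<lambda>u. proj_point (\<phi> u)) ` kantor_vectors"
      proof cases
        case 1
        then show ?thesis
          using infinity unfolding kantor_vectors_def by (intro image_eqI[of _ _ "(0, 0, 0, 1)"]) auto
      next
        case 2
        then show ?thesis
          using affine[of x y z] \<Lambda>[of x y z] unfolding kantor_vectors_def
          by (intro image_eqI[of _ _ "(1, \<Lambda> x y z, \<Lambda> x y z ^ (CARD('k) + CARD('k) ^ 2), N3 (\<Lambda> x y z))"]) auto
      qed
    qed
    show "(\<lambda>u. proj_point (\<phi> u)) ` kantor_vectors \<subseteq> O7 f1 f2 f3"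
    proof
      fix P
      assume "P \<in> (\<lambda>u. proj_point (\<phi> u)) ` kantor_vectors"
      then consider "P = proj_point (\<phi> (0, 0, 0, 1))"
        | t where "t \<in> Fq3" "P = proj_point (\<phi> (1, t, t ^ (CARD('k) + CARD('k) ^ 2), N3 t))"
        unfolding kantor_vectors_def by blast
      then show "P \<in> O7 f1 f2 f3"
      proof cases
        case 1
        then show ?thesis
          unfolding infinity O7_def by blast
      next
        case 2
        then obtain x y z where "t = \<Lambda> x y z"
          using \<Lambda>_surj by blast
        then have "P = proj_point (p x y z)"
          using 2 affine by simp
        then show ?thesis
          unfolding O7_def p_def by blast
      qed
    qed
  qed
  then show ?thesis
    unfolding is_kantor_ovoid_def using iso by blast
qed

theorem theorem4p1:
  fixes f1 f2 f3 :: "'k::{field, finite} poly3"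
  assumes "real CARD('k) > 6.3 * 3 powr (13 / 3)"
    and "total_degree3 f1 = 2" and "total_degree3 f2 = 2" and "total_degree3 f3 = 2"
    and "eval3 f1 0 0 0 = 0" and "eval3 f2 0 0 0 = 0" and "eval3 f3 0 0 0 = 0"
    and "is_ovoid Q7 (O7 f1 f2 f3)"
  shows "even CARD('k) \<and> is_kantor_ovoid (O7 f1 f2 f3)"
proof -
  \<comment> \<open>Bounding the power below by 3 gives \<open>q > 18.9\<close>, hence
    \<open>q \<ge> 16\<close>.\<close>
  have "(3::real) powr 1 \<le> 3 powr (13 / 3)"
    by (intro powr_mono) auto
  then have "real CARD('k) \<ge> 16"
    using assms(1) by simp
  then have card: "CARD('k) \<ge> 16"
    by linarith
  obtain a1 b1 c1 a2 b2 c2 a3 b3 c3 e l m n where two: "(2::'k) = 0"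
    and f: "\<And>x y z. eval3 f1 x y z = a1 * x\<^sup>2 + b1 * y\<^sup>2 + c1 * z\<^sup>2 + e * x * y + (l * x + m * y)"
      "\<And>x y z. eval3 f2 x y z = a2 * x\<^sup>2 + b2 * y\<^sup>2 + c2 * z\<^sup>2 + e * x * z + (n * x + m * z)"
      "\<And>x y z. eval3 f3 x y z = a3 * x\<^sup>2 + b3 * y\<^sup>2 + c3 * z\<^sup>2 + e * y * z + (n * y + l * z)"
    and aniso: "\<And>x y z. x * (a3 * x\<^sup>2 + b3 * y\<^sup>2 + c3 * z\<^sup>2 + e * y * z) +
      y * (a2 * x\<^sup>2 + b2 * y\<^sup>2 + c2 * z\<^sup>2 + e * x * z) +
      z * (a1 * x\<^sup>2 + b1 * y\<^sup>2 + c1 * z\<^sup>2 + e * x * y) = 0 \<Longrightarrow> x = 0 \<and> y = 0 \<and> z = 0"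
    using O7_normal_form[OF card assms(2-8)] by metis
  obtain h where h: "CARD('k) = 2 ^ h"
    using char2_card[OF two] .
  then have "h \<noteq> 0"
    using card by (cases h) auto
  then have "even CARD('k)"
    by (simp add: h)
  moreover have "is_kantor_ovoid (O7 f1 f2 f3)"
    using two card f aniso by (rule O7_is_kantor_ovoid)
  ultimately show ?thesis
    by blast
qed

end
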